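(* Let $E$ be a complex Banach lattice, let $A : E \supseteq \operatorname{dom}(A) \to E$ be a closed, densely defined, and real linear operator, let $\lambda_0 \in \mathbb{R}$ be an isolated spectral value of $A$ and a pole of the resolvent $\mathcal{R}(\cdot,A)$, and let $u \in E$ be a quasi-interior point. Assume that there exists an integer $n \ge 0$ such that $\operatorname{dom}(A^n) \subseteq E_u$. Then the following assertions are equivalent. (i) For every $f\in E$ with $0 \lneq f$, we have $\mathcal{R}(\mu,A)f \preceq -u$ for all $\mu$ in an $f$-dependent left neighbourhood of $\lambda_0$, and $\mathcal{R}(\lambda,A)f \succeq u$ for all $\lambda$ in an $f$-dependent right neighbourhood of $\lambda_0$. (ii) The spectral assumption (defined in the context) is satisfied and, for every $0 \le f \in E$, we have $\mathcal{R}(\mu,A)f \le 0$ for all $\mu$ in an $f$-dependent left neighbourhood of $\lambda_0$, and $\mathcal{R}(\lambda,A)f \ge 0$ for all $\lambda$ in an $f$-dependent right neighbourhood of $\lambda_0$. (iii) The spectral assumption is satisfied and $\operatorname{dom}(A) \subseteq E_u$.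
   Context: $E_{\mathbb{R}}$ and $E_+$ denote the real part and the positive cone of $E$; $0 \lneq f$ means $f \ge 0$ and $f \neq 0$. For $0 \lneq u \in E$, the principal ideal generated by $u$ is $E_u := \{f \in E : \text{there exists } c>0 \text{ with } |f| \le cu\}$; $u$ is called a quasi-interior point of $E$ if $E_u$ is dense in $E$. A linear operator $A$ on $E$ is called real if $\operatorname{dom}(A) = \operatorname{dom}(A)\cap E_{\mathbb{R}} + i\,(\operatorname{dom}(A)\cap E_{\mathbb{R}})$ and $A(\operatorname{dom}(A)\cap E_{\mathbb{R}}) \subseteq E_{\mathbb{R}}$. $\mathcal{R}(\lambda,A) = (\lambda-A)^{-1}$ for $\lambda$ in the resolvent set $\rho(A)$. By convention $A^0$ is the identity, with domain $E$. For $x,y \in E_{\mathbb{R}}$, we write $x \succeq y$ (equivalently $y \preceq x$) if there exists a real number $c>0$ such that $x \ge cy$ (in (i), $c$ may depend on $f$ and on $\mu$, respectively $\lambda$). A left (right) neighbourhood of $\lambda_0$ is a set of real numbers of the form $(\lambda_0-\varepsilon,\lambda_0)$ (respectively $(\lambda_0,\lambda_0+\varepsilon)$) with $\varepsilon>0$, contained in $\rho(A)$. Spectral assumption: the eigenvalue $\lambda_0$ of $A$ is geometrically simple and the eigenspace $\ker(\lambda_0-A)$ is spanned by a vector $v$ which satisfies $v \succeq u$; moreover, the dual eigenspace $\ker(\lambda_0-A')$ (where $A'$ is the dual operator on the dual space $E'$) contains a strictly positive functional $\varphi$, i.e. $\varphi \in E'$ with $\langle \varphi, f\rangle > 0$ for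 all $0 \lneq f \in E$. *)

theory Defs
  imports
    "HOL-Analysis.Analysis"
    "HOL-Library.Lattice_Algebras"
    "HOL-Library.Complex_Order"
begin

section \<open>Real Banach lattices\<close>

class banach_lattice = banach + ordered_real_vector + lattice_ab_group_add_abs +
  assumes norm_mono: "\<bar>x\<bar> \<le> \<bar>y\<bar> \<Longrightarrow> norm x \<le> norm y"

instance real :: banach_lattice
proof
  fix x y :: real
  assume "\<bar>x\<bar> \<le> \<bar>y\<bar>"
  thus "norm x \<le> norm y" by simp
qed

lemma norm_abs_lattice [simp]: "norm \<bar>x :: 'a :: banach_lattice\<bar> = norm x"
  by (intro antisym norm_mono) simp_all

lemma norm_mono_nonneg: "0 \<le> x \<Longrightarrow> x \<le> y \<Longrightarrow> norm x \<le> norm y"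
  for x y :: "'a :: banach_lattice"
  by (rule norm_mono) (use order_trans in fastforce)

lemma nonneg_closed_lattice:
  fixes x :: "'a :: banach_lattice"
  assumes "X \<longlonglongrightarrow> x" and "\<And>n. 0 \<le> X n"
  shows "0 \<le> x"
proof -
  have *: "- nprt x \<le> \<bar>x - X n\<bar>" for n
  proof -
    have "X n - \<bar>x - X n\<bar> \<le> x"
      using abs_ge_minus_self[of "x - X n"] by (simp add: algebra_simps)
    moreover have "- \<bar>x - X n\<bar> \<le> X n - \<bar>x - X n\<bar>"
      using add_right_mono[OF assms(2)[of n], of "- \<bar>x - X n\<bar>"] by simp
    ultimately have "- \<bar>x - X n\<bar> \<le> x" by (rule order_trans[rotated])
    hence "- \<bar>x - X n\<bar> \<le> nprt x" by (simp add: nprt_def)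
    thus ?thesis by (simp add: minus_le_iff)
  qed
  have "norm (nprt x) \<le> norm (x - X n)" for n
    using norm_mono_nonneg[OF _ *[of n]] by simp
  moreover have "(\<lambda>n. norm (x - X n)) \<longlonglongrightarrow> 0"
    using tendsto_norm[OF tendsto_diff[OF tendsto_const[of x] assms(1)]] by simp
  ultimately have "norm (nprt x) \<le> 0"
    by (meson LIMSEQ_le_const)
  thus ?thesis by (simp add: zero_le_iff_zero_nprt)
qed

lemma le_limit_lattice:
  fixes x y :: "'a :: banach_lattice"
  assumes "X \<longlonglongrightarrow> x" "Y \<longlonglongrightarrow> y" and "\<And>n. X n \<le> Y n"
  shows "x \<le> y"
  using nonneg_closed_lattice[OF tendsto_diff[OF assms(2,1)]] assms(3) by simp

section \<open>Complexification\<close>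

datatype 'a complexification = Cplx (re: 'a) (im: 'a)

lemma complexification_eqI: "re z = re w \<Longrightarrow> im z = im w \<Longrightarrow> z = w"
  by (rule complexification.expand) simp

instantiation complexification :: (real_vector) real_vector
begin

definition "0 = Cplx 0 0"
definition "z + w = Cplx (re z + re w) (im z + im w)"
definition "- z = Cplx (- re z) (- im z)"
definition "z - w = Cplx (re z - re w) (im z - im w)"
definition "r *\<^sub>R z = Cplx (r *\<^sub>R re z) (r *\<^sub>R im z)"

instance
  by standard
    (auto simp: zero_complexification_def plus_complexification_def
      uminus_complexification_def minus_complexification_def
      scaleR_complexification_def scaleR_add_right scaleR_add_left intro!: complexification_eqI)

end

lemma re_im_simps [simp]:
  "re 0 = 0" "im 0 = 0"
  "re (z + w) = re z + re w" "im (z + w) = im z + im w"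
  "re (- z) = - re z" "im (- z) = - im z"
  "re (z - w) = re z - re w" "im (z - w) = im z - im w"
  "re (r *\<^sub>R z) = r *\<^sub>R re z" "im (r *\<^sub>R z) = r *\<^sub>R im z"
  for z w :: "'a :: real_vector complexification"
  by (simp_all add: zero_complexification_def plus_complexification_def
      uminus_complexification_def minus_complexification_def scaleR_complexification_def)

definition scaleC :: "complex \<Rightarrow> 'a :: real_vector complexification \<Rightarrow> 'a complexification"
    (infixr \<open>*\<^sub>C\<close> 75)
  where "c *\<^sub>C z = Cplx (Re c *\<^sub>R re z - Im c *\<^sub>R im z) (Re c *\<^sub>R im z + Im c *\<^sub>R re z)"

lemma re_im_scaleC [simp]:
  "re (c *\<^sub>C z) = Re c *\<^sub>R re z - Im c *\<^sub>R im z"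
  "im (c *\<^sub>C z) = Re c *\<^sub>R im z + Im c *\<^sub>R re z"
  by (simp_all add: scaleC_def)

lemma scaleC_of_real [simp]: "complex_of_real r *\<^sub>C z = r *\<^sub>R z"
  by (simp add: complexification_eqI)

global_interpretation complexification: vector_space scaleC
  by unfold_locales (auto intro!: complexification_eqI simp: algebra_simps)

definition real_part :: "'a :: real_vector complexification set"
  where "real_part = {z. im z = 0}"

text \<open>The order is the one induced by the cone \<open>E\<^sub>+ \<subseteq> E\<^sub>\<real>\<close>: \<open>z \<le> w\<close> means
  \<open>w - z \<in> E\<^sub>+\<close>. In particular \<open>0 < f\<close> means \<open>f \<in> E\<^sub>+\<close> and \<open>f \<noteq> 0\<close>.\<close>

instantiation complexification :: ("{real_vector, order}") order
begin

definition "z \<le> w \<longleftrightarrow> re z \<le> re w \<and> im z = im w"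
definition "z < w \<longleftrightarrow> re z < re w \<and> im z = im w"

instance
  by standard
    (auto simp: less_eq_complexification_def less_complexification_def intro!: complexification_eqI)

end

text \<open>The modulus \<open>|x + i y| = sup\<^sub>\<theta> (cos \<theta> x + sin \<theta> y)\<close>; the supremum exists in every
  Banach lattice (lemma \<open>modulus_is_lub\<close> below).\<close>

definition modulus :: "'a :: banach_lattice complexification \<Rightarrow> 'a"
  where "modulus z = (THE m. (\<forall>\<theta>. cos \<theta> *\<^sub>R re z + sin \<theta> *\<^sub>R im z \<le> m) \<and>
    (\<forall>m'. (\<forall>\<theta>. cos \<theta> *\<^sub>R re z + sin \<theta> *\<^sub>R im z \<le> m') \<longrightarrow> m \<le> m'))"

lemma scaleR_le_abs:
  fixes x :: "'a :: banach_lattice"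
  assumes "\<bar>r\<bar> \<le> e"
  shows "r *\<^sub>R x \<le> e *\<^sub>R \<bar>x\<bar>"
proof -
  have "r *\<^sub>R x \<le> \<bar>r\<bar> *\<^sub>R \<bar>x\<bar>"
  proof (cases "0 \<le> r")
    case True
    thus ?thesis using scaleR_left_mono[OF abs_ge_self[of x] True] by simp
  next
    case False
    hence "(- r) *\<^sub>R (- x) \<le> (- r) *\<^sub>R \<bar>x\<bar>"
      by (intro scaleR_left_mono abs_ge_minus_self) auto
    thus ?thesis using False by simp
  qed
  also have "\<dots> \<le> e *\<^sub>R \<bar>x\<bar>" by (intro scaleR_right_mono assms) simp
  finally show ?thesis .
qed

lemma finite_angle_net:
  assumes "0 < e"
  shows "\<exists>F :: real set. finite F \<and> F \<noteq> {} \<and>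
    (\<forall>\<theta>. \<exists>\<phi>\<in>F. \<bar>cos \<theta> - cos \<phi>\<bar> \<le> e \<and> \<bar>sin \<theta> - sin \<phi>\<bar> \<le> e)"
proof -
  have "compact (sphere (0::complex) 1)" by simp
  then obtain k :: "complex set"
    where k: "finite k" "k \<subseteq> sphere 0 1" "sphere 0 1 \<subseteq> (\<Union>x\<in>k. ball x e)"
    using seq_compact_imp_totally_bounded[of "sphere (0::complex) 1"] assms
    by (auto simp: compact_eq_seq_compact_metric)
  have net: "\<exists>\<phi>\<in>Arg ` k. \<bar>cos \<theta> - cos \<phi>\<bar> \<le> e \<and> \<bar>sin \<theta> - sin \<phi>\<bar> \<le> e" for \<theta>
  proof -
    have "cis \<theta> \<in> sphere 0 1" by simp
    hence "cis \<theta> \<in> (\<Union>x\<in>k. ball x e)" using k(3) by blast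
    then obtain x where x: "x \<in> k" "dist x (cis \<theta>) < e" by auto
    have "norm x = 1" using x k(2) by auto
    hence cx: "cis (Arg x) = x" using rcis_cmod_Arg[of x] by (simp add: rcis_def)
    have "\<bar>Re (cis \<theta> - x)\<bar> \<le> e" "\<bar>Im (cis \<theta> - x)\<bar> \<le> e"
      using x(2) abs_Re_le_cmod[of "cis \<theta> - x"] abs_Im_le_cmod[of "cis \<theta> - x"]
      by (auto simp: dist_norm norm_minus_commute)
    moreover have "cos (Arg x) = Re x" "sin (Arg x) = Im x" using cx by (metis cis.simps)+
    ultimately show ?thesis using x(1) by (intro bexI[of _ "Arg x"]) simp_all
  qed
  show ?thesis using k(1) net by (intro exI[of _ "Arg ` k"]) blast
qed

lemma modulus_ex:
  fixes x y :: "'a :: banach_lattice"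
  shows "\<exists>m. (\<forall>\<theta>. cos \<theta> *\<^sub>R x + sin \<theta> *\<^sub>R y \<le> m) \<and>
    (\<forall>m'. (\<forall>\<theta>. cos \<theta> *\<^sub>R x + sin \<theta> *\<^sub>R y \<le> m') \<longrightarrow> m \<le> m')"
proof -
  define g where "g \<theta> = cos \<theta> *\<^sub>R x + sin \<theta> *\<^sub>R y" for \<theta>
  define w where "w = \<bar>x\<bar> + \<bar>y\<bar>"
  define d where "d n = inverse (real (Suc n))" for n
  have d: "0 < d n" for n by (simp add: d_def)
  have d0: "d \<longlonglongrightarrow> 0" unfolding d_def by (rule LIMSEQ_inverse_real_of_nat)
  have "\<forall>n. \<exists>F. finite F \<and> F \<noteq> {} \<and>
    (\<forall>\<theta>. \<exists>\<phi>\<in>F. \<bar>cos \<theta> - cos \<phi>\<bar> \<le> d n \<and> \<bar>sin \<theta> - sin \<phi>\<bar> \<le> d n)"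
    using finite_angle_net d by blast
  then obtain F where F: "\<And>n. finite (F n)" "\<And>n. F n \<noteq> {}"
    "\<And>n \<theta>. \<exists>\<phi>\<in>F n. \<bar>cos \<theta> - cos \<phi>\<bar> \<le> d n \<and> \<bar>sin \<theta> - sin \<phi>\<bar> \<le> d n"
    by metis
  define s where "s n = Sup_fin (g ` F n)" for n
  have gs: "g \<phi> \<le> s n" if "\<phi> \<in> F n" for \<phi> n
    unfolding s_def using F that by (intro Sup_fin.coboundedI) auto
  have sle: "s n \<le> m" if "\<And>\<phi>. g \<phi> \<le> m" for n m
    unfolding s_def using F that by (intro Sup_fin.boundedI) auto
  have g_le: "g \<theta> \<le> s n + d n *\<^sub>R w" for \<theta> n
  proof -
    obtain \<phi> where \<phi>: "\<phi> \<in> F n" "\<bar>cos \<theta> - cos \<phi>\<bar> \<le> d n" "\<bar>sin \<theta> - sin \<phi>\<bar> \<le> d n"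
      using F(3) by blast
    have "g \<theta> = g \<phi> + ((cos \<theta> - cos \<phi>) *\<^sub>R x + (sin \<theta> - sin \<phi>) *\<^sub>R y)"
      by (simp add: g_def algebra_simps)
    also have "\<dots> \<le> s n + (d n *\<^sub>R \<bar>x\<bar> + d n *\<^sub>R \<bar>y\<bar>)"
      by (intro add_mono gs scaleR_le_abs \<phi>)
    finally show ?thesis by (simp add: w_def scaleR_add_right)
  qed
  have w0: "0 \<le> w" by (simp add: w_def)
  have s_le: "s n \<le> s m + d m *\<^sub>R w" for n m using sle g_le by blast
  have diff: "norm (s n - s m) \<le> (d n + d m) * norm w" for n m
  proof -
    have 1: "s n - s m \<le> (d n + d m) *\<^sub>R w"
    proof -
      have "s n - s m \<le> d m *\<^sub>R w" using s_le[of n m] by (simp add: diff_le_eq add.commute)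
      also have "\<dots> \<le> (d n + d m) *\<^sub>R w"
        using d[of n] by (intro scaleR_right_mono w0) simp
      finally show ?thesis .
    qed
    have 2: "- (s n - s m) \<le> (d n + d m) *\<^sub>R w"
    proof -
      have "s m - s n \<le> d n *\<^sub>R w" using s_le[of m n] by (simp add: diff_le_eq add.commute)
      also have "\<dots> \<le> (d n + d m) *\<^sub>R w"
        using d[of m] by (intro scaleR_right_mono w0) simp
      finally show ?thesis by simp
    qed
    have "\<bar>s n - s m\<bar> \<le> (d n + d m) *\<^sub>R w" using abs_leI[OF 1 2] .
    hence "norm (s n - s m) \<le> norm ((d n + d m) *\<^sub>R w)"
      using norm_mono_nonneg[OF abs_ge_zero] by fastforce
    thus ?thesis using d[of n] d[of m] by simp
  qed
  have "Cauchy s"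
  proof (rule metric_CauchyI)
    fix e :: real assume "0 < e"
    have "(\<lambda>n. d n * norm w) \<longlonglongrightarrow> 0" using tendsto_mult_left_zero[OF d0] by simp
    then obtain N where N: "\<And>n. n \<ge> N \<Longrightarrow> d n * norm w < e / 2"
      using order_tendstoD(2)[of _ 0 sequentially "e/2"] \<open>0 < e\<close>
      unfolding eventually_sequentially by fastforce
    have "dist (s m) (s n) < e" if "m \<ge> N" "n \<ge> N" for m n
      using diff[of m n] N[OF that(1)] N[OF that(2)] by (simp add: dist_norm algebra_simps)
    thus "\<exists>M. \<forall>m\<ge>M. \<forall>n\<ge>M. dist (s m) (s n) < e" by blast
  qed
  then obtain m where m: "s \<longlonglongrightarrow> m" using Cauchy_convergent convergent_def by blast
  have lim: "(\<lambda>n. s n + d n *\<^sub>R w) \<longlonglongrightarrow> m"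
    using tendsto_add[OF m tendsto_scaleR[OF d0 tendsto_const[of w]]] by simp
  have "g \<theta> \<le> m" for \<theta> by (rule le_limit_lattice[OF tendsto_const lim]) (rule g_le)
  moreover have "m \<le> m'" if "\<And>\<theta>. g \<theta> \<le> m'" for m'
    by (rule le_limit_lattice[OF m tendsto_const]) (rule sle, rule that)
  ultimately show ?thesis unfolding g_def by blast
qed

lemma modulus_is_lub:
  "(\<forall>\<theta>. cos \<theta> *\<^sub>R re z + sin \<theta> *\<^sub>R im z \<le> modulus z) \<and>
    (\<forall>m'. (\<forall>\<theta>. cos \<theta> *\<^sub>R re z + sin \<theta> *\<^sub>R im z \<le> m') \<longrightarrow> modulus z \<le> m')"
  unfolding modulus_def by (rule theI') (metis modulus_ex antisym)

lemma modulus_upper: "cos \<theta> *\<^sub>R re z + sin \<theta> *\<^sub>R im z \<le> modulus z"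
  using modulus_is_lub by blast

lemma modulus_least:
  "(\<And>\<theta>. cos \<theta> *\<^sub>R re z + sin \<theta> *\<^sub>R im z \<le> m) \<Longrightarrow> modulus z \<le> m"
  using modulus_is_lub by blast

lemma abs_re_le_modulus: "\<bar>re z\<bar> \<le> modulus z"
  using modulus_upper[of 0 z] modulus_upper[of pi z] by (intro abs_leI) auto

lemma abs_im_le_modulus: "\<bar>im z\<bar> \<le> modulus z"
  using modulus_upper[of "pi/2" z] modulus_upper[of "- pi/2" z] by (intro abs_leI) auto

lemma modulus_nonneg [simp]: "0 \<le> modulus z"
  using abs_ge_zero abs_re_le_modulus by (rule order_trans)

lemma modulus_le_abs_add: "modulus z \<le> \<bar>re z\<bar> + \<bar>im z\<bar>"
proof (rule modulus_least)
  fix \<theta>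
  show "cos \<theta> *\<^sub>R re z + sin \<theta> *\<^sub>R im z \<le> \<bar>re z\<bar> + \<bar>im z\<bar>"
    using add_mono[OF scaleR_le_abs[of "cos \<theta>" 1 "re z"] scaleR_le_abs[of "sin \<theta>" 1 "im z"]]
    by simp
qed

lemma modulus_real: "im z = 0 \<Longrightarrow> modulus z = \<bar>re z\<bar>"
  using modulus_le_abs_add[of z] abs_re_le_modulus[of z] by (intro antisym) auto

lemma modulus_eq_0_iff [simp]: "modulus z = 0 \<longleftrightarrow> z = 0"
proof
  assume "modulus z = 0"
  thus "z = 0"
    using abs_re_le_modulus[of z] abs_im_le_modulus[of z]
    by (intro complexification_eqI) auto
next
  show "z = 0 \<Longrightarrow> modulus z = 0" by (simp add: modulus_real)
qed

lemma modulus_triangle: "modulus (z + w) \<le> modulus z + modulus w"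
proof (rule modulus_least)
  fix \<theta>
  show "cos \<theta> *\<^sub>R re (z + w) + sin \<theta> *\<^sub>R im (z + w) \<le> modulus z + modulus w"
    using add_mono[OF modulus_upper[of \<theta> z] modulus_upper[of \<theta> w]]
    by (simp add: algebra_simps)
qed

lemma modulus_scaleC_le: "modulus (c *\<^sub>C z) \<le> cmod c *\<^sub>R modulus z"
proof (rule modulus_least)
  fix \<theta>
  define \<phi> where "\<phi> = \<theta> - Arg c"
  have c: "Re c = cmod c * cos (Arg c)" "Im c = cmod c * sin (Arg c)"
    by (metis Re_rcis rcis_cmod_Arg, metis Im_rcis rcis_cmod_Arg)
  have cos: "cmod c * cos \<phi> = cos \<theta> * Re c + sin \<theta> * Im c"
    and sin: "cmod c * sin \<phi> = sin \<theta> * Re c - cos \<theta> * Im c"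
    by (simp_all add: \<phi>_def cos_diff sin_diff c algebra_simps)
  have "cos \<theta> *\<^sub>R re (c *\<^sub>C z) + sin \<theta> *\<^sub>R im (c *\<^sub>C z)
      = (cos \<theta> * Re c + sin \<theta> * Im c) *\<^sub>R re z + (sin \<theta> * Re c - cos \<theta> * Im c) *\<^sub>R im z"
    by (simp add: algebra_simps)
  also have "\<dots> = cmod c *\<^sub>R (cos \<phi> *\<^sub>R re z + sin \<phi> *\<^sub>R im z)"
    by (simp add: scaleR_add_right flip: cos sin)
  also have "\<dots> \<le> cmod c *\<^sub>R modulus z"
    by (intro scaleR_left_mono modulus_upper) simp
  finally show "cos \<theta> *\<^sub>R re (c *\<^sub>C z) + sin \<theta> *\<^sub>R im (c *\<^sub>C z) \<le> cmod c *\<^sub>R modulus z" .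
qed

lemma modulus_scaleC: "modulus (c *\<^sub>C z) = cmod c *\<^sub>R modulus z"
proof (cases "c = 0")
  case False
  have "modulus z = modulus (inverse c *\<^sub>C c *\<^sub>C z)" using False by simp
  also have "\<dots> \<le> cmod (inverse c) *\<^sub>R modulus (c *\<^sub>C z)" by (rule modulus_scaleC_le)
  finally have "cmod c *\<^sub>R modulus z \<le> cmod c *\<^sub>R (cmod (inverse c) *\<^sub>R modulus (c *\<^sub>C z))"
    by (rule scaleR_left_mono) simp
  also have "\<dots> = modulus (c *\<^sub>C z)" using False by (simp add: norm_inverse)
  finally show ?thesis using modulus_scaleC_le[of c z] by (rule antisym[rotated])
qed simp

instantiation complexification :: (banach_lattice) real_normed_vector
begin

definition "norm z = norm (modulus z)"
definition "dist z w = norm (z - w)" for z w :: "'a complexification"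
definition "sgn z = inverse (norm z) *\<^sub>R z" for z :: "'a complexification"
definition "uniformity = (INF e\<in>{0<..}. principal {(z :: 'a complexification, w). dist z w < e})"
definition "open U \<longleftrightarrow> (\<forall>z\<in>U. \<forall>\<^sub>F (z', w) in uniformity. z' = z \<longrightarrow> w \<in> U)"
  for U :: "'a complexification set"

instance
proof
  fix z w :: "'a complexification" and r :: real
  show "norm z = 0 \<longleftrightarrow> z = 0" by (simp add: norm_complexification_def)
  have "norm (modulus (z + w)) \<le> norm (modulus z + modulus w)"
    by (intro norm_mono_nonneg modulus_nonneg modulus_triangle)
  thus "norm (z + w) \<le> norm z + norm w"
    unfolding norm_complexification_def using norm_triangle_ineq order_trans by blast
  show "norm (r *\<^sub>R z) = \<bar>r\<bar> * norm z"
    using modulus_scaleC[of "complex_of_real r" z] by (simp add: norm_complexification_def)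
qed (simp_all add: dist_complexification_def sgn_complexification_def
      uniformity_complexification_def open_complexification_def)

end

lemma norm_re_le: "norm (re z) \<le> norm z"
  using norm_mono_nonneg[OF abs_ge_zero abs_re_le_modulus[of z]]
  by (simp add: norm_complexification_def)

lemma norm_im_le: "norm (im z) \<le> norm z"
  using norm_mono_nonneg[OF abs_ge_zero abs_im_le_modulus[of z]]
  by (simp add: norm_complexification_def)

lemma norm_le_re_im: "norm z \<le> norm (re z) + norm (im z)"
  using norm_mono_nonneg[OF modulus_nonneg modulus_le_abs_add[of z]]
    norm_triangle_ineq[of "\<bar>re z\<bar>" "\<bar>im z\<bar>"]
  by (simp add: norm_complexification_def)

lemma norm_scaleC: "norm (c *\<^sub>C z) = cmod c * norm z"
  by (simp add: norm_complexification_def modulus_scaleC)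

instance complexification :: (banach_lattice) banach
proof
  fix X :: "nat \<Rightarrow> 'a complexification"
  assume X: "Cauchy X"
  have "bounded_linear (re :: 'a complexification \<Rightarrow> 'a)"
    by (rule bounded_linear_intro[of _ 1]) (auto simp: norm_re_le)
  hence "Cauchy (\<lambda>n. re (X n))" using X by (rule bounded_linear.Cauchy)
  then obtain a where a: "(\<lambda>n. re (X n)) \<longlonglongrightarrow> a"
    using Cauchy_convergent convergent_def by blast
  have "bounded_linear (im :: 'a complexification \<Rightarrow> 'a)"
    by (rule bounded_linear_intro[of _ 1]) (auto simp: norm_im_le)
  hence "Cauchy (\<lambda>n. im (X n))" using X by (rule bounded_linear.Cauchy)
  then obtain b where b: "(\<lambda>n. im (X n)) \<longlonglongrightarrow> b"
    using Cauchy_convergent convergent_def by blast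
  have "(\<lambda>n. norm (re (X n) - a) + norm (im (X n) - b)) \<longlonglongrightarrow> 0"
    using tendsto_add[OF tendsto_norm[OF LIM_zero[OF a]] tendsto_norm[OF LIM_zero[OF b]]] by simp
  hence "(\<lambda>n. X n - Cplx a b) \<longlonglongrightarrow> 0"
    by (rule tendsto_0_le[of _ _ _ 1])
      (use norm_le_re_im[of "X _ - Cplx a b"] in \<open>auto intro!: always_eventually simp: norm_le_re_im[THEN order_trans]\<close>)
  thus "convergent X" unfolding convergent_def using LIM_zero_cancel by blast
qed

section \<open>Ideals and quasi-interior points\<close>

definition principal_ideal ::
    "'a :: banach_lattice complexification \<Rightarrow> 'a complexification set"
  where "principal_ideal u = {f. \<exists>c>0. Cplx (modulus f) 0 \<le> c *\<^sub>R u}"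

definition quasi_interior :: "'a :: banach_lattice complexification \<Rightarrow> bool"
  where "quasi_interior u \<longleftrightarrow> 0 < u \<and> closure (principal_ideal u) = UNIV"

text \<open>\<open>x \<succeq> y\<close>. Only meant for real \<open>x\<close> and \<open>y\<close>; if \<open>y\<close> is real, then so is \<open>x\<close> whenever the
  relation holds (and vice versa), since \<open>x - c y\<close> is required to lie in \<open>E\<^sub>+\<close>.\<close>

definition dominates ::
    "'a :: banach_lattice complexification \<Rightarrow> 'a complexification \<Rightarrow> bool" (infix \<open>\<succeq>\<close> 50)
  where "x \<succeq> y \<longleftrightarrow> (\<exists>c::real. c > 0 \<and> x \<ge> c *\<^sub>R y)"

abbreviation dominated ::
    "'a :: banach_lattice complexification \<Rightarrow> 'a complexification \<Rightarrow> bool" (infix \<open>\<preceq>\<close> 50)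
  where "y \<preceq> x \<equiv> x \<succeq> y"

section \<open>Unbounded operators\<close>

text \<open>An operator \<open>E \<supseteq> dom(A) \<rightarrow> E\<close> is given by its domain \<open>D\<close> and a total function \<open>A\<close> whose
  values outside \<open>D\<close> are irrelevant.\<close>

definition linear_operator ::
    "'a :: real_vector complexification set \<Rightarrow> ('a complexification \<Rightarrow> 'a complexification) \<Rightarrow> bool"
  where "linear_operator D A \<longleftrightarrow> complexification.subspace D \<and>
    (\<forall>x\<in>D. \<forall>y\<in>D. A (x + y) = A x + A y) \<and> (\<forall>c. \<forall>x\<in>D. A (c *\<^sub>C x) = c *\<^sub>C A x)"

definition closed_operator :: "'a :: topological_space set \<Rightarrow> ('a \<Rightarrow> 'a) \<Rightarrow> bool"
  where "closed_operator D A \<longleftrightarrow> closed {(x, A x) | x. x \<in> D}"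

definition densely_defined :: "'a :: topological_space set \<Rightarrow> bool"
  where "densely_defined D \<longleftrightarrow> closure D = UNIV"

definition real_operator ::
    "'a :: real_vector complexification set \<Rightarrow> ('a complexification \<Rightarrow> 'a complexification) \<Rightarrow> bool"
  where "real_operator D A \<longleftrightarrow>
    D = {x + \<i> *\<^sub>C y | x y. x \<in> D \<inter> real_part \<and> y \<in> D \<inter> real_part} \<and>
    A ` (D \<inter> real_part) \<subseteq> real_part"

primrec dom_power :: "'a set \<Rightarrow> ('a \<Rightarrow> 'a) \<Rightarrow> nat \<Rightarrow> 'a set"
  where
    "dom_power D A 0 = UNIV"
  | "dom_power D A (Suc n) = {x \<in> D. A x \<in> dom_power D A n}"

definition resolvent_set ::
    "'a :: banach_lattice complexification set \<Rightarrow> ('a complexification \<Rightarrow> 'a complexification)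
      \<Rightarrow> complex set"
  where "resolvent_set D A = {l. bij_betw (\<lambda>x. l *\<^sub>C x - A x) D UNIV \<and>
    bounded_linear (inv_into D (\<lambda>x. l *\<^sub>C x - A x))}"

definition resolvent ::
    "complex \<Rightarrow> 'a :: banach_lattice complexification set \<Rightarrow>
      ('a complexification \<Rightarrow> 'a complexification) \<Rightarrow> 'a complexification \<Rightarrow> 'a complexification"
  where "resolvent l D A = inv_into D (\<lambda>x. l *\<^sub>C x - A x)"

definition op_spectrum ::
    "'a :: banach_lattice complexification set \<Rightarrow> ('a complexification \<Rightarrow> 'a complexification)
      \<Rightarrow> complex set"
  where "op_spectrum D A = - resolvent_set D A"

text \<open>\<open>l0\<close> is a pole of the resolvent: in a punctured neighbourhood of \<open>l0\<close> there is an expansion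
  \<open>R(l, A) = \<Sum>\<^bsub>k \<ge> -p\<^esub> (l - l0)\<^sup>k U\<^sub>k\<close> with \<open>p \<ge> 1\<close> and \<open>U\<^bsub>-p\<^esub> \<noteq> 0\<close>, convergent in operator norm;
  here \<open>U j\<close> is the coefficient of \<open>(l - l0)\<^bsup>j - p\<^esup>\<close>. The library's \<open>is_pole\<close> (norm tends to infinity)
  is not suitable for operator-valued functions: by \<open>norm R(l, A) \<ge> 1 / dist l (spectrum)\<close> it
  holds at every isolated spectral value, including essential singularities.\<close>

definition pole_of_resolvent ::
    "complex \<Rightarrow> 'a :: banach_lattice complexification set \<Rightarrow>
      ('a complexification \<Rightarrow> 'a complexification) \<Rightarrow> bool"
  where "pole_of_resolvent l0 D A \<longleftrightarrow>
    (\<exists>p::nat. p \<ge> 1 \<and>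
      (\<exists>U :: nat \<Rightarrow> 'a complexification \<Rightarrow> 'a complexification. \<exists>\<epsilon>>0.
        (\<forall>j. bounded_linear (U j) \<and> (\<forall>c x. U j (c *\<^sub>C x) = c *\<^sub>C U j x)) \<and>
        U 0 \<noteq> (\<lambda>x. 0) \<and>
        (\<forall>l. 0 < cmod (l - l0) \<and> cmod (l - l0) < \<epsilon> \<longrightarrow> l \<in> resolvent_set D A \<and>
          (\<lambda>N. onorm (\<lambda>x. resolvent l D A x - (\<Sum>j<N. ((l - l0) powi (int j - int p)) *\<^sub>C U j x)))
            \<longlonglongrightarrow> 0)))"

definition eigenspace ::
    "complex \<Rightarrow> 'a :: real_vector complexification set \<Rightarrow>
      ('a complexification \<Rightarrow> 'a complexification) \<Rightarrow> 'a complexification set"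
  where "eigenspace l D A = {x \<in> D. l *\<^sub>C x - A x = 0}"

section \<open>Duality\<close>

definition dual_space :: "('a :: banach_lattice complexification \<Rightarrow> complex) set"
  where "dual_space = {\<phi>. bounded_linear \<phi> \<and> (\<forall>c x. \<phi> (c *\<^sub>C x) = c * \<phi> x)}"

definition dual_dom ::
    "'a :: banach_lattice complexification set \<Rightarrow> ('a complexification \<Rightarrow> 'a complexification)
      \<Rightarrow> ('a complexification \<Rightarrow> complex) set"
  where "dual_dom D A = {\<phi> \<in> dual_space. \<exists>\<psi>\<in>dual_space. \<forall>x\<in>D. \<phi> (A x) = \<psi> x}"

text \<open>The functional \<open>\<psi>\<close> is unique because \<open>D\<close> is dense in all uses.\<close>

definition dual_op ::
    "'a :: banach_lattice complexification set \<Rightarrow> ('a complexification \<Rightarrow> 'a complexification)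
      \<Rightarrow> ('a complexification \<Rightarrow> complex) \<Rightarrow> ('a complexification \<Rightarrow> complex)"
  where "dual_op D A \<phi> = (THE \<psi>. \<psi> \<in> dual_space \<and> (\<forall>x\<in>D. \<phi> (A x) = \<psi> x))"

definition dual_eigenspace ::
    "complex \<Rightarrow> 'a :: banach_lattice complexification set \<Rightarrow>
      ('a complexification \<Rightarrow> 'a complexification) \<Rightarrow> ('a complexification \<Rightarrow> complex) set"
  where "dual_eigenspace l D A = {\<phi> \<in> dual_dom D A. \<forall>x. l * \<phi> x - dual_op D A \<phi> x = 0}"

text \<open>The order on \<open>\<complex>\<close> is that of \<^theory>\<open>HOL-Library.Complex_Order\<close>: \<open>0 < c\<close> means that
  \<open>c\<close> is real and positive.\<close>

definition strictly_positive :: "('a :: banach_lattice complexification \<Rightarrow> complex) \<Rightarrow> bool"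
  where "strictly_positive \<phi> \<longleftrightarrow> \<phi> \<in> dual_space \<and> (\<forall>f. 0 < f \<longrightarrow> 0 < \<phi> f)"

definition spectral_assumption ::
    "real \<Rightarrow> 'a :: banach_lattice complexification set \<Rightarrow>
      ('a complexification \<Rightarrow> 'a complexification) \<Rightarrow> 'a complexification \<Rightarrow> bool"
  where "spectral_assumption l0 D A u \<longleftrightarrow>
    complexification.dim (eigenspace (of_real l0) D A) = 1 \<and>
    (\<exists>v. eigenspace (of_real l0) D A = complexification.span {v} \<and> v \<succeq> u) \<and>
    (\<exists>\<phi>\<in>dual_eigenspace (of_real l0) D A. strictly_positive \<phi>)"

end

theory Submission
  imports Defs
begin

text \<open>Put \<open>T(l) = (l - l0) R(l)\<close> for real \<open>l\<close> near \<open>l0\<close>. The sign conditions to the left and to the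
  right of \<open>l0\<close> then merge into one: eventual positivity says that \<open>T(l) f \<ge> 0\<close> for \<open>f \<ge> 0\<close>, and
  strong positivity that \<open>T(l) f \<succeq> u\<close> for \<open>f > 0\<close>, in each case for all \<open>l\<close> in a punctured
  neighbourhood of \<open>l0\<close> that depends on \<open>f\<close>. Strong positivity implies eventual positivity. The
  equivalences then rest on three ideas.

  \<^item> \<^emph>\<open>Positivity on both sides shrinks the domain.\<close> For \<open>m < l0 < l\<close> the resolvent identity says that
    \<open>T(m) T(l)\<close> is a convex combination of \<open>T(l)\<close> and \<open>T(m)\<close>. If both of these map \<open>g\<close> into the cone,
    then \<open>T(l) g\<close> is at most a multiple of \<open>T(m) T(l) g\<close>, which lies in the domain of one more power
    of \<open>A\<close>. So an inclusion \<open>dom (A\<^sup>n\<^sup>+\<^sup>2) \<subseteq> E\<^sub>u\<close> improves to \<open>dom (A\<^sup>n\<^sup>+\<^sup>1) \<subseteq> E\<^sub>u\<close>, and by descent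
    to \<open>dom A \<subseteq> E\<^sub>u\<close> (\<open>eventual_positivity_imp_domain_subset\<close>). The points \<open>l\<close> and \<open>m\<close> depend on
    \<open>g\<close>; this is harmless because replacing one resolvent by another changes a vector only by
    something in the domain of the next power (\<open>dom_power_spanned_by_positive\<close>).

  \<^item> \<^emph>\<open>Strong positivity yields the spectral assumption\<close>
    (\<open>strong_positivity_imp_spectral_assumption\<close>). Let \<open>U\<close> be the leading Laurent coefficient at the
    pole, and \<open>p\<close> its order. It is positive, its range consists of eigenvectors, and by strong
    positivity a positive nonzero eigenvector dominates \<open>u\<close>. A positive operator that vanishes at a
    vector that dominates \<open>u\<close> is zero, since \<open>E\<^sub>u\<close> is dense. This excludes \<open>U\<^sup>2 = 0\<close>, so \<open>p = 1\<close>, and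
    it yields \<open>U f \<noteq> 0\<close> for \<open>f > 0\<close>. As \<open>dom A \<subseteq> E\<^sub>u\<close>, any two positive nonzero eigenvectors dominate
    each other, which forces the eigenspace to be spanned by a single \<open>v\<close>; then \<open>U f = \<phi>(f) v\<close>
    defines the strictly positive dual eigenvector \<open>\<phi>\<close>.

  \<^item> \<^emph>\<open>The spectral assumption and \<open>dom A \<subseteq> E\<^sub>u\<close> yield strong positivity\<close>
    (\<open>spectral_assumption_imp_strong_positivity\<close>). Pairing with \<open>\<phi>\<close> shows that the pole is simple
    and that \<open>U f\<close> is a positive multiple of \<open>v\<close> for \<open>f > 0\<close>, hence dominates \<open>u\<close>. Because
    \<open>dom A \<subseteq> E\<^sub>u\<close>, a resolvent operator is bounded from \<open>E\<close> to \<open>E\<^sub>u\<close> with its gauge norm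
    (\<open>bounded_operator_into_principal_ideal\<close>). Therefore \<open>T(l) f\<close> tends to \<open>U f\<close> relative to \<open>u\<close>,
    and \<open>T(l) f\<close> inherits the lower bound by a multiple of \<open>u\<close> for \<open>l\<close> near \<open>l0\<close>, on both sides.\<close>

section \<open>The ordered complex space\<close>

instance complexification :: (banach_lattice) ordered_real_vector
proof
  fix x y z :: "'a complexification" and a b :: real
  show "x \<le> y \<Longrightarrow> z + x \<le> z + y"
    by (simp add: less_eq_complexification_def)
  show "x \<le> y \<Longrightarrow> 0 \<le> a \<Longrightarrow> a *\<^sub>R x \<le> a *\<^sub>R y"
    by (simp add: less_eq_complexification_def scaleR_left_mono)
  show "a \<le> b \<Longrightarrow> 0 \<le> x \<Longrightarrow> a *\<^sub>R x \<le> b *\<^sub>R x"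
    by (auto simp: less_eq_complexification_def scaleR_right_mono dest: sym)
qed

lemma bounded_linear_re: "bounded_linear (re :: 'a :: banach_lattice complexification \<Rightarrow> 'a)"
  by (rule bounded_linear_intro[of _ 1]) (auto simp: norm_re_le)

lemma bounded_linear_im: "bounded_linear (im :: 'a :: banach_lattice complexification \<Rightarrow> 'a)"
  by (rule bounded_linear_intro[of _ 1]) (auto simp: norm_im_le)

lemma bounded_linear_scaleC:
  "bounded_linear (\<lambda>z :: 'a :: banach_lattice complexification. c *\<^sub>C z)"
  by (rule bounded_linear_intro[of _ "cmod c"])
    (auto intro!: complexification_eqI simp: norm_scaleC algebra_simps)

lemma closed_nonneg: "closed {x :: 'a :: banach_lattice. 0 \<le> x}"
  unfolding closed_sequential_limits using nonneg_closed_lattice by auto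

lemma closed_nonneg_complexification: "closed {z :: 'a :: banach_lattice complexification. 0 \<le> z}"
proof -
  have "{z :: 'a complexification. 0 \<le> z} = re -` {x. 0 \<le> x} \<inter> im -` {0}"
    by (auto simp: less_eq_complexification_def)
  thus ?thesis
    by (simp only:) (intro closed_Int closed_vimage closed_nonneg closed_singleton
        linear_continuous_on bounded_linear_re bounded_linear_im)
qed

lemma tendsto_nonneg_complexification:
  fixes x :: "'a :: banach_lattice complexification"
  assumes "(f \<longlongrightarrow> x) F" "F \<noteq> bot" "\<forall>\<^sub>F t in F. 0 \<le> f t"
  shows "0 \<le> x"
  using Lim_in_closed_set[OF closed_nonneg_complexification _ assms(2,1)] assms(3) by simp

text \<open>Every \<open>x + i y\<close> is a complex combination of the positive and negative parts of \<open>x\<close> and \<open>y\<close>.\<close>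

lemma complex_subspace_contains_all:
  fixes V :: "'a :: banach_lattice complexification set"
  assumes V: "complexification.subspace V" and pos: "\<And>f. 0 \<le> f \<Longrightarrow> f \<in> V"
  shows "z \<in> V"
proof -
  have real: "Cplx x 0 \<in> V" for x
  proof -
    have "Cplx x 0 = Cplx (pprt x) 0 - Cplx (- nprt x) 0"
      using prts[of x] by (auto intro!: complexification_eqI)
    moreover have "Cplx (pprt x) 0 \<in> V" "Cplx (- nprt x) 0 \<in> V"
      by (auto intro!: pos simp: less_eq_complexification_def)
    ultimately show ?thesis using complexification.subspace_diff[OF V] by simp
  qed
  have "z = Cplx (re z) 0 + \<i> *\<^sub>C Cplx (im z) 0"
    by (auto intro!: complexification_eqI)
  moreover have "Cplx (re z) 0 + \<i> *\<^sub>C Cplx (im z) 0 \<in> V"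
    by (intro complexification.subspace_add complexification.subspace_scale V real)
  ultimately show ?thesis by simp
qed

lemma mem_principal_ideal_iff:
  assumes "0 \<le> u"
  shows "f \<in> principal_ideal u \<longleftrightarrow> (\<exists>c>0. modulus f \<le> c *\<^sub>R re u)"
  using assms by (simp add: principal_ideal_def less_eq_complexification_def)

lemma principal_ideal_subspace:
  assumes "0 \<le> u"
  shows "complexification.subspace (principal_ideal u)"
proof (rule complexification.subspaceI)
  have u: "0 \<le> re u" using assms by (simp add: less_eq_complexification_def)
  show "0 \<in> principal_ideal u"
    using u by (auto simp: mem_principal_ideal_iff[OF assms] modulus_real intro!: exI[of _ 1])
  show "f + g \<in> principal_ideal u" if "f \<in> principal_ideal u" "g \<in> principal_ideal u" for f g
  proof -
    from that obtain c d where cd: "c > 0" "d > 0"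
      "modulus f \<le> c *\<^sub>R re u" "modulus g \<le> d *\<^sub>R re u"
      by (auto simp: mem_principal_ideal_iff[OF assms])
    have "modulus (f + g) \<le> (c + d) *\<^sub>R re u"
      using order_trans[OF modulus_triangle add_mono[OF cd(3,4)]] by (simp add: scaleR_add_left)
    thus ?thesis using cd(1,2)
      by (auto simp: mem_principal_ideal_iff[OF assms] intro!: exI[of _ "c + d"])
  qed
  show "k *\<^sub>C f \<in> principal_ideal u" if "f \<in> principal_ideal u" for k f
  proof -
    from that obtain c where c: "c > 0" "modulus f \<le> c *\<^sub>R re u"
      by (auto simp: mem_principal_ideal_iff[OF assms])
    have "modulus (k *\<^sub>C f) \<le> cmod k *\<^sub>R c *\<^sub>R re u"
      unfolding modulus_scaleC by (intro scaleR_left_mono c) simp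
    also have "\<dots> \<le> (cmod k * c + 1) *\<^sub>R re u"
      using u by (simp add: scaleR_add_left)
    finally show ?thesis using c(1)
      by (auto simp: mem_principal_ideal_iff[OF assms] intro!: exI[of _ "cmod k * c + 1"]
          add_nonneg_pos)
  qed
qed

lemma principal_ideal_solid:
  assumes "0 \<le> u" "0 \<le> f" "f \<le> g" "g \<in> principal_ideal u"
  shows "f \<in> principal_ideal u"
proof -
  have "0 \<le> g" using assms(2,3) by (rule order_trans)
  hence "modulus f = re f" "modulus g = re g" "re f \<le> re g"
    using assms(2,3) by (auto simp: less_eq_complexification_def modulus_real)
  thus ?thesis using assms(4) by (auto simp: mem_principal_ideal_iff[OF assms(1)] intro: order_trans)
qed

text \<open>By positivity, \<open>S\<close> annihilates everything between \<open>0\<close> and a multiple of \<open>u\<close>, hence the dense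
  ideal generated by \<open>u\<close>.\<close>

lemma positive_operator_zero_at_quasi_interior:
  fixes S :: "'a :: banach_lattice complexification \<Rightarrow> 'a complexification"
  assumes S: "bounded_linear S" "\<And>c f. S (c *\<^sub>C f) = c *\<^sub>C S f"
    and pos: "\<And>f. 0 \<le> f \<Longrightarrow> 0 \<le> S f"
    and u: "quasi_interior u" "S u = 0"
  shows "S f = 0"
proof -
  interpret S: bounded_linear S by fact
  have u0: "0 \<le> u" using u(1) by (simp add: quasi_interior_def less_imp_le)
  have nn: "S g = 0" if g: "0 \<le> g" "g \<le> c *\<^sub>R u" for g c
  proof -
    have "0 \<le> S (c *\<^sub>R u - g)" using g by (intro pos) simp
    hence "S g \<le> 0" using u(2) by (simp add: S.diff S.scaleR)
    with pos[OF g(1)] show ?thesis by (rule antisym[rotated])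
  qed
  have rl: "S (Cplx x 0) = 0" if x: "\<bar>x\<bar> \<le> c *\<^sub>R re u" for x c
  proof -
    have "pprt x \<le> \<bar>x\<bar>" "- nprt x \<le> \<bar>x\<bar>"
      by (simp_all add: abs_prts)
    hence "Cplx (pprt x) 0 \<le> c *\<^sub>R u" "Cplx (- nprt x) 0 \<le> c *\<^sub>R u"
      using x u0 by (auto simp: less_eq_complexification_def)
    hence "S (Cplx (pprt x) 0) = 0" "S (Cplx (- nprt x) 0) = 0"
      by (auto intro!: nn simp: less_eq_complexification_def)
    moreover have "Cplx x 0 = Cplx (pprt x) 0 - Cplx (- nprt x) 0"
      using prts[of x] by (auto intro!: complexification_eqI)
    ultimately show ?thesis by (simp add: S.diff)
  qed
  have "S g = 0" if g: "g \<in> principal_ideal u" for g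
  proof -
    obtain c where c: "modulus g \<le> c *\<^sub>R re u"
      using g mem_principal_ideal_iff[OF u0, of g] by blast
    have "S (Cplx (re g) 0) = 0" "S (Cplx (im g) 0) = 0"
      using order_trans[OF abs_re_le_modulus c] order_trans[OF abs_im_le_modulus c] rl by auto
    moreover have "g = Cplx (re g) 0 + \<i> *\<^sub>C Cplx (im g) 0"
      by (auto intro!: complexification_eqI)
    ultimately show ?thesis using S.add S(2) by (metis complexification.scale_zero_right add_0)
  qed
  hence "principal_ideal u \<subseteq> {g. S g = 0}" by blast
  moreover have "closed {g. S g = 0}"
    by (intro closed_Collect_eq continuous_on_const linear_continuous_on S(1))
  ultimately have "closure (principal_ideal u) \<subseteq> {g. S g = 0}" by (rule closure_minimal)
  thus ?thesis using u(1) by (auto simp: quasi_interior_def)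
qed

lemma dominates_imp_pos:
  assumes "0 < u" "x \<succeq> u"
  shows "0 < x"
proof -
  from assms(2) obtain c where c: "c > 0" "c *\<^sub>R u \<le> x" by (auto simp: dominates_def)
  have "0 \<le> c *\<^sub>R u" using assms(1) c by (simp add: scaleR_nonneg_nonneg less_imp_le)
  moreover have "c *\<^sub>R u \<noteq> 0" using assms(1) c by auto
  ultimately have "0 < c *\<^sub>R u" by (simp add: less_le)
  thus ?thesis using c(2) by (rule less_le_trans)
qed

lemma dominates_scaleR_pos:
  assumes "0 < r" "x \<succeq> u"
  shows "r *\<^sub>R x \<succeq> u"
proof -
  from assms(2) obtain c where c: "c > 0" "c *\<^sub>R u \<le> x" by (auto simp: dominates_def)
  have "(r * c) *\<^sub>R u \<le> r *\<^sub>R x"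
    using scaleR_left_mono[OF c(2), of r] assms(1) by simp
  thus ?thesis using c(1) assms(1) unfolding dominates_def by (metis mult_pos_pos)
qed

lemma dominates_scaleR_pos_iff: "0 < r \<Longrightarrow> r *\<^sub>R x \<succeq> u \<longleftrightarrow> x \<succeq> u"
  using dominates_scaleR_pos[of r x u] dominates_scaleR_pos[of "inverse r" "r *\<^sub>R x" u] by auto

lemma uminus_dominates_iff: "- u \<succeq> x \<longleftrightarrow> - x \<succeq> u"
proof -
  have *: "- y \<succeq> z" if "- z \<succeq> y" for y z :: "'a complexification"
  proof -
    from that obtain c where c: "c > 0" "c *\<^sub>R y \<le> - z" by (auto simp: dominates_def)
    have "inverse c *\<^sub>R c *\<^sub>R y \<le> inverse c *\<^sub>R (- z)"
      using c by (intro scaleR_left_mono) auto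
    hence "inverse c *\<^sub>R z \<le> - y" using c(1) by (simp add: le_minus_iff)
    thus ?thesis using c(1) unfolding dominates_def by (metis positive_imp_inverse_positive)
  qed
  show ?thesis using *[of u x] *[of x u] by blast
qed

lemma dominates_scaleR_neg_iff:
  assumes "r < 0"
  shows "r *\<^sub>R x \<succeq> u \<longleftrightarrow> - u \<succeq> x"
  using dominates_scaleR_pos_iff[of "- r" "- x" u] assms by (simp add: uminus_dominates_iff)

lemma dominates_trans_ideal:
  assumes "0 \<le> u" "x \<succeq> u" "0 \<le> w" "w \<in> principal_ideal u"
  shows "x \<succeq> w"
proof -
  from assms(2) obtain c where c: "c > 0" "c *\<^sub>R u \<le> x" by (auto simp: dominates_def)
  from assms(4) obtain d where d: "d > 0" "modulus w \<le> d *\<^sub>R re u"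
    using mem_principal_ideal_iff[OF assms(1), of w] by blast
  have "w \<le> d *\<^sub>R u"
    using assms(1,3) d(2) by (simp add: less_eq_complexification_def modulus_real)
  hence "(c / d) *\<^sub>R w \<le> (c / d) *\<^sub>R d *\<^sub>R u" using c d by (intro scaleR_left_mono) auto
  also have "\<dots> \<le> x" using c d by simp
  finally show ?thesis using c d unfolding dominates_def by (metis divide_pos_pos)
qed

section \<open>Resolvents and powers of the domain\<close>

locale complex_linear_operator =
  fixes D :: "'a :: banach_lattice complexification set"
    and A :: "'a complexification \<Rightarrow> 'a complexification"
  assumes linear: "linear_operator D A"
begin

abbreviation R :: "complex \<Rightarrow> 'a complexification \<Rightarrow> 'a complexification"
  where "R l \<equiv> resolvent l D A"

abbreviation \<rho> :: "complex set"
  where "\<rho> \<equiv> resolvent_set D A"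

lemma subspace_D: "complexification.subspace D"
  using linear by (simp add: linear_operator_def)

lemma A_add: "x \<in> D \<Longrightarrow> y \<in> D \<Longrightarrow> A (x + y) = A x + A y"
  and A_scaleC: "x \<in> D \<Longrightarrow> A (c *\<^sub>C x) = c *\<^sub>C A x"
  using linear by (auto simp: linear_operator_def)

lemma bounded_linear_R: "l \<in> \<rho> \<Longrightarrow> bounded_linear (R l)"
  by (simp add: resolvent_set_def resolvent_def)

lemma R_mem_D: "l \<in> \<rho> \<Longrightarrow> R l f \<in> D"
  unfolding resolvent_set_def resolvent_def bij_betw_def by (auto intro: inv_into_into)

lemma A_R:
  assumes "l \<in> \<rho>"
  shows "A (R l f) = l *\<^sub>C R l f - f"
proof -
  have "l *\<^sub>C R l f - A (R l f) = f"
    using assms unfolding resolvent_set_def resolvent_def bij_betw_def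
    by (auto intro: f_inv_into_f[of f "\<lambda>x. l *\<^sub>C x - A x" D])
  thus ?thesis by (simp add: algebra_simps)
qed

lemma R_eqI:
  assumes "l \<in> \<rho>" "x \<in> D" "l *\<^sub>C x - A x = f"
  shows "R l f = x"
  using assms inv_into_f_f[of "\<lambda>x. l *\<^sub>C x - A x" D x]
  unfolding resolvent_set_def resolvent_def bij_betw_def by auto

lemma R_scaleC:
  assumes "l \<in> \<rho>"
  shows "R l (c *\<^sub>C f) = c *\<^sub>C R l f"
proof (rule R_eqI[OF assms])
  show "c *\<^sub>C R l f \<in> D"
    by (intro complexification.subspace_scale subspace_D R_mem_D assms)
  show "l *\<^sub>C c *\<^sub>C R l f - A (c *\<^sub>C R l f) = c *\<^sub>C f"
    by (simp add: A_scaleC R_mem_D A_R assms complexification.scale_right_diff_distrib mult.commute)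
qed

lemma resolvent_identity:
  assumes "a \<in> \<rho>" "b \<in> \<rho>"
  shows "R a f = R b f + (b - a) *\<^sub>C R a (R b f)"
proof -
  interpret Ra: bounded_linear "R a" by (rule bounded_linear_R[OF assms(1)])
  have "R a (f + (a - b) *\<^sub>C R b f) = R b f"
    by (rule R_eqI[OF assms(1) R_mem_D[OF assms(2)]])
      (simp add: A_R assms complexification.scale_left_diff_distrib)
  hence "R a f + (a - b) *\<^sub>C R a (R b f) = R b f"
    by (simp add: Ra.add R_scaleC assms)
  thus ?thesis by (simp add: complexification.scale_left_diff_distrib algebra_simps)
qed

lemma resolvent_identity_real:
  assumes "complex_of_real a \<in> \<rho>" "complex_of_real b \<in> \<rho>"
  shows "R (complex_of_real a) f = R (complex_of_real b) f
    + (b - a) *\<^sub>R R (complex_of_real a) (R (complex_of_real b) f)"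
  using resolvent_identity[OF assms, of f] unfolding of_real_diff[symmetric] scaleC_of_real .

lemma resolvent_commute:
  assumes "a \<in> \<rho>" "b \<in> \<rho>"
  shows "R a (R b f) = R b (R a f)"
proof (cases "a = b")
  case False
  have "(b - a) *\<^sub>C R a (R b f) = R a f - R b f"
    using resolvent_identity[OF assms, of f] by (metis add_diff_cancel_left')
  also have "\<dots> = - (R b f - R a f)" by simp
  also have "R b f - R a f = (a - b) *\<^sub>C R b (R a f)"
    using resolvent_identity[OF assms(2,1), of f] by (metis add_diff_cancel_left')
  also have "- ((a - b) *\<^sub>C R b (R a f)) = (b - a) *\<^sub>C R b (R a f)"
    by (simp flip: complexification.scale_minus_left)
  finally have "(b - a) *\<^sub>C R a (R b f) = (b - a) *\<^sub>C R b (R a f)" .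
  thus ?thesis using False by simp
qed simp

lemma subspace_eigenspace:
  "complexification.subspace (eigenspace l D A)"
proof -
  have A0: "A 0 = 0" using A_scaleC[OF complexification.subspace_0[OF subspace_D], of 0] by simp
  show ?thesis
  proof (rule complexification.subspaceI)
    show "0 \<in> eigenspace l D A"
      using complexification.subspace_0[OF subspace_D] A0 by (simp add: eigenspace_def)
    show "x + y \<in> eigenspace l D A" if "x \<in> eigenspace l D A" "y \<in> eigenspace l D A" for x y
      using that complexification.subspace_add[OF subspace_D]
      by (simp add: eigenspace_def A_add complexification.scale_right_distrib)
    show "c *\<^sub>C x \<in> eigenspace l D A" if "x \<in> eigenspace l D A" for c x
      using that complexification.subspace_scale[OF subspace_D]
        complexification.scale_left_commute[of l c x]
      by (simp add: eigenspace_def A_scaleC)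
  qed
qed

lemma R_eigenvector:
  assumes "l \<in> \<rho>" "x \<in> eigenspace m D A"
  shows "(l - m) *\<^sub>C R l x = x"
proof -
  have x: "x \<in> D" "A x = m *\<^sub>C x" using assms(2) by (auto simp: eigenspace_def)
  have "R l ((l - m) *\<^sub>C x) = x"
    by (rule R_eqI[OF assms(1) x(1)]) (simp add: x complexification.scale_left_diff_distrib)
  thus ?thesis by (simp add: R_scaleC assms)
qed

lemma eigenvectorI:
  assumes "l \<in> \<rho>" "(l - m) *\<^sub>C R l x = x"
  shows "x \<in> eigenspace m D A"
proof -
  define y where "y = (l - m) *\<^sub>C R l x"
  have "y \<in> D"
    unfolding y_def by (intro complexification.subspace_scale subspace_D R_mem_D assms)
  moreover have "A y = (l - m) *\<^sub>C (l *\<^sub>C R l x - x)"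
    unfolding y_def by (simp add: A_scaleC R_mem_D A_R assms(1))
  moreover have "\<dots> = l *\<^sub>C y - (l - m) *\<^sub>C x"
    by (simp add: y_def complexification.scale_right_diff_distrib mult.commute)
  moreover have "y = x" using assms(2) by (simp add: y_def)
  ultimately show ?thesis
    by (simp add: eigenspace_def complexification.scale_left_diff_distrib)
qed

lemma subspace_dom_power: "complexification.subspace (dom_power D A n)"
proof (induction n)
  case (Suc n)
  have A0: "A 0 = 0" using A_scaleC[OF complexification.subspace_0[OF subspace_D], of 0] by simp
  show ?case
    using complexification.subspace_0[OF Suc.IH] complexification.subspace_add[OF Suc.IH]
      complexification.subspace_scale[OF Suc.IH] complexification.subspace_0[OF subspace_D]
      complexification.subspace_add[OF subspace_D] complexification.subspace_scale[OF subspace_D]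
    by (auto intro!: complexification.subspaceI simp: A0 A_add A_scaleC)
qed (simp add: complexification.subspace_UNIV)

lemma dom_power_Suc_subset: "dom_power D A (Suc n) \<subseteq> dom_power D A n"
  by (induction n) auto

lemma R_mem_dom_power_Suc:
  assumes "l \<in> \<rho>"
  shows "f \<in> dom_power D A n \<Longrightarrow> R l f \<in> dom_power D A (Suc n)"
proof (induction n arbitrary: f)
  case (Suc n)
  hence "f \<in> dom_power D A n" using dom_power_Suc_subset by blast
  hence "R l f \<in> dom_power D A (Suc n)" by (rule Suc.IH)
  hence "A (R l f) \<in> dom_power D A (Suc n)"
    unfolding A_R[OF assms]
    by (intro complexification.subspace_diff complexification.subspace_scale subspace_dom_power
        Suc.prems)
  thus ?case using R_mem_D[OF assms] by simp
qed (simp add: R_mem_D assms)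

lemma dom_power_Suc_eq_range:
  assumes "l \<in> \<rho>"
  shows "dom_power D A (Suc n) = R l ` dom_power D A n"
proof (intro equalityI subsetI)
  fix x assume x: "x \<in> dom_power D A (Suc n)"
  hence "l *\<^sub>C x - A x \<in> dom_power D A n"
    using dom_power_Suc_subset
    by (intro complexification.subspace_diff complexification.subspace_scale subspace_dom_power) auto
  moreover have "R l (l *\<^sub>C x - A x) = x" using x by (intro R_eqI assms) auto
  ultimately show "x \<in> R l ` dom_power D A n" by (metis imageI)
qed (use R_mem_dom_power_Suc[OF assms] in blast)

lemma subspace_vimage_R:
  assumes "l \<in> \<rho>" "complexification.subspace V"
  shows "complexification.subspace (R l -` V)"
proof -
  interpret bounded_linear "R l" by (rule bounded_linear_R[OF assms(1)])
  show ?thesis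
    by (intro complexification.subspaceI)
      (auto simp: zero add R_scaleC assms(1) complexification.subspace_0
        complexification.subspace_add complexification.subspace_scale assms(2))
qed

text \<open>Split \<open>R(l) f = a + i b\<close> into real parts in the domain. Since \<open>f\<close> and \<open>l\<close> are real, comparing
  imaginary parts gives \<open>(l - A) b = 0\<close>, so \<open>b = 0\<close>.\<close>

lemma R_real:
  assumes "real_operator D A" "complex_of_real l \<in> \<rho>" "im f = 0"
  shows "im (R (complex_of_real l) f) = 0"
proof -
  let ?x = "R (complex_of_real l) f"
  have "?x \<in> {x + \<i> *\<^sub>C y | x y. x \<in> D \<inter> real_part \<and> y \<in> D \<inter> real_part}"
    using assms(1) R_mem_D[OF assms(2)] unfolding real_operator_def by blast
  then obtain a b where ab: "?x = a + \<i> *\<^sub>C b" "a \<in> D" "b \<in> D" "im a = 0" "im b = 0"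
    by (auto simp: real_part_def)
  have Aab: "im (A a) = 0" "im (A b) = 0"
    using assms(1) ab unfolding real_operator_def real_part_def by auto
  have "A ?x = A a + \<i> *\<^sub>C A b"
    unfolding ab(1) using ab(2,3) by (simp add: A_add A_scaleC complexification.subspace_scale subspace_D)
  hence "f = l *\<^sub>R ?x - (A a + \<i> *\<^sub>C A b)"
    using A_R[OF assms(2), of f] by (simp add: algebra_simps)
  hence "im f = l *\<^sub>R im (a + \<i> *\<^sub>C b) - im (A a + \<i> *\<^sub>C A b)"
    unfolding ab(1) using re_im_simps by metis
  hence "im f = l *\<^sub>R re b - re (A b)" using ab Aab by simp
  hence "complex_of_real l *\<^sub>C b - A b = 0"
    using ab Aab assms(3) by (auto intro!: complexification_eqI)
  hence "R (complex_of_real l) 0 = b" by (intro R_eqI assms ab)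
  moreover have "R (complex_of_real l) 0 = 0"
    using linear_simps(3)[OF bounded_linear_R[OF assms(2)]] .
  ultimately show ?thesis using ab by simp
qed

end

section \<open>Sign conditions on the resolvent\<close>

text \<open>The factor \<open>l - l0\<close> is negative to the left of \<open>l0\<close>. It turns the opposite signs of the
  resolvent on the two sides into one condition along the filter \<open>at l0\<close>.\<close>

definition individually_eventually_positive ::
    "real \<Rightarrow> 'a :: banach_lattice complexification set
      \<Rightarrow> ('a complexification \<Rightarrow> 'a complexification) \<Rightarrow> bool"
  where "individually_eventually_positive l0 D A \<longleftrightarrow> (\<forall>f\<ge>0. \<forall>\<^sub>F l in at l0.
    complex_of_real l \<in> resolvent_set D A \<and> 0 \<le> (l - l0) *\<^sub>R resolvent (complex_of_real l) D A f)"

definition individually_strongly_positive ::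
    "real \<Rightarrow> 'a :: banach_lattice complexification set
      \<Rightarrow> ('a complexification \<Rightarrow> 'a complexification) \<Rightarrow> 'a complexification \<Rightarrow> bool"
  where "individually_strongly_positive l0 D A u \<longleftrightarrow> (\<forall>f>0. \<forall>\<^sub>F l in at l0.
    complex_of_real l \<in> resolvent_set D A \<and> (l - l0) *\<^sub>R resolvent (complex_of_real l) D A f \<succeq> u)"

lemma two_sided_neighbourhoods_iff_eventually:
  fixes x :: real
  shows "(\<exists>\<epsilon>>0. \<forall>y\<in>{x - \<epsilon><..<x}. P y) \<and> (\<exists>\<epsilon>>0. \<forall>y\<in>{x<..<x + \<epsilon>}. Q y) \<longleftrightarrow>
    (\<forall>\<^sub>F y in at x. (y < x \<longrightarrow> P y) \<and> (x < y \<longrightarrow> Q y))"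
proof -
  have "(\<exists>\<epsilon>>0. \<forall>y\<in>{x - \<epsilon><..<x}. P y) \<longleftrightarrow> (\<forall>\<^sub>F y in at_left x. P y)"
    unfolding eventually_at_left_field
  proof safe
    fix \<epsilon> :: real assume "\<epsilon> > 0" "\<forall>y\<in>{x - \<epsilon><..<x}. P y"
    thus "\<exists>b<x. \<forall>y>b. y < x \<longrightarrow> P y" by (intro exI[of _ "x - \<epsilon>"]) auto
  next
    fix b assume "b < x" "\<forall>y>b. y < x \<longrightarrow> P y"
    thus "\<exists>\<epsilon>>0. \<forall>y\<in>{x - \<epsilon><..<x}. P y" by (intro exI[of _ "x - b"]) auto
  qed
  moreover have "(\<exists>\<epsilon>>0. \<forall>y\<in>{x<..<x + \<epsilon>}. Q y) \<longleftrightarrow> (\<forall>\<^sub>F y in at_right x. Q y)"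
    unfolding eventually_at_right_field
  proof safe
    fix \<epsilon> :: real assume "\<epsilon> > 0" "\<forall>y\<in>{x<..<x + \<epsilon>}. Q y"
    thus "\<exists>b>x. \<forall>y>x. y < b \<longrightarrow> Q y" by (intro exI[of _ "x + \<epsilon>"]) auto
  next
    fix b assume "x < b" "\<forall>y>x. y < b \<longrightarrow> Q y"
    thus "\<exists>\<epsilon>>0. \<forall>y\<in>{x<..<x + \<epsilon>}. Q y" by (intro exI[of _ "b - x"]) auto
  qed
  moreover have "(\<forall>\<^sub>F y in at_left x. P y) \<longleftrightarrow> (\<forall>\<^sub>F y in at_left x. (y < x \<longrightarrow> P y) \<and> (x < y \<longrightarrow> Q y))"
    "(\<forall>\<^sub>F y in at_right x. Q y) \<longleftrightarrow> (\<forall>\<^sub>F y in at_right x. (y < x \<longrightarrow> P y) \<and> (x < y \<longrightarrow> Q y))"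
    unfolding eventually_at_filter by (intro arg_cong[of _ _ "\<lambda>Q. eventually Q _"] ext; auto)+
  ultimately show ?thesis unfolding eventually_at_split[of _ x] by blast
qed

lemma strong_positivity_iff:
  "(\<forall>f > 0.
      (\<exists>\<epsilon>>0. \<forall>\<mu>\<in>{l0 - \<epsilon><..<l0}.
        complex_of_real \<mu> \<in> resolvent_set D A \<and> resolvent (complex_of_real \<mu>) D A f \<preceq> - u) \<and>
      (\<exists>\<epsilon>>0. \<forall>l\<in>{l0<..<l0 + \<epsilon>}.
        complex_of_real l \<in> resolvent_set D A \<and> resolvent (complex_of_real l) D A f \<succeq> u))
    \<longleftrightarrow> individually_strongly_positive l0 D A u"
  unfolding two_sided_neighbourhoods_iff_eventually individually_strongly_positive_def
  by (intro all_cong1 imp_cong refl eventually_cong[OF eventually_neq_at_within])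
    (auto simp: dominates_scaleR_neg_iff dominates_scaleR_pos_iff linorder_neq_iff)

lemma eventual_positivity_iff:
  "(\<forall>f \<ge> 0.
      (\<exists>\<epsilon>>0. \<forall>\<mu>\<in>{l0 - \<epsilon><..<l0}.
        complex_of_real \<mu> \<in> resolvent_set D A \<and> resolvent (complex_of_real \<mu>) D A f \<le> 0) \<and>
      (\<exists>\<epsilon>>0. \<forall>l\<in>{l0<..<l0 + \<epsilon>}.
        complex_of_real l \<in> resolvent_set D A \<and> 0 \<le> resolvent (complex_of_real l) D A f))
    \<longleftrightarrow> individually_eventually_positive l0 D A"
  unfolding two_sided_neighbourhoods_iff_eventually individually_eventually_positive_def
  by (intro all_cong1 imp_cong refl eventually_cong[OF eventually_neq_at_within])
    (auto simp: zero_le_scaleR_iff linorder_neq_iff)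

lemma strong_imp_eventual_positivity:
  assumes "individually_strongly_positive l0 D A u" "0 < u"
  shows "individually_eventually_positive l0 D A"
  unfolding individually_eventually_positive_def
proof (intro allI impI)
  fix f :: "'a complexification" assume f: "0 \<le> f"
  show "\<forall>\<^sub>F l in at l0. complex_of_real l \<in> resolvent_set D A \<and>
      0 \<le> (l - l0) *\<^sub>R resolvent (complex_of_real l) D A f"
  proof (cases "f = 0")
    case False
    hence "0 < f" using f by (simp add: less_le)
    hence "\<forall>\<^sub>F l in at l0. complex_of_real l \<in> resolvent_set D A \<and>
        (l - l0) *\<^sub>R resolvent (complex_of_real l) D A f \<succeq> u"
      using assms(1) by (simp add: individually_strongly_positive_def)
    thus ?thesis
      by eventually_elim (use dominates_imp_pos[OF assms(2)] in \<open>auto simp: less_imp_le\<close>)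
  next
    case True
    have "\<forall>\<^sub>F l in at l0. complex_of_real l \<in> resolvent_set D A"
      using assms by (auto simp: individually_strongly_positive_def elim: eventually_mono)
    thus ?thesis
      by eventually_elim
        (auto simp: True resolvent_set_def resolvent_def linear_simps(3))
  qed
qed

section \<open>Eventual positivity shrinks the domain\<close>

context complex_linear_operator
begin

lemma eventually_positive_imp_resolvent_point:
  assumes "individually_eventually_positive l0 D A"
  obtains a where "a \<in> \<rho>"
proof -
  have "\<forall>\<^sub>F l in at l0. complex_of_real l \<in> \<rho>"
    using assms unfolding individually_eventually_positive_def
    by (auto dest: spec[of _ 0] elim: eventually_mono)
  from eventually_happens'[OF _ this] show thesis using that by auto
qed

text \<open>The operator \<open>R(a)\<close> maps \<open>dom (A\<^sup>k)\<close> onto \<open>dom (A\<^sup>k\<^sup>+\<^sup>1)\<close>. It need not preserve the cone, but for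
  a positive \<open>g\<close> in \<open>dom (A\<^sup>k)\<close> the vector \<open>R(a) g\<close> may be replaced by a vector \<open>R(l) g\<close> of definite
  sign, where \<open>l\<close> depends on \<open>g\<close>: the difference of the two is a multiple of \<open>R(a) R(l) g\<close> and thus
  lies in \<open>dom (A\<^sup>k\<^sup>+\<^sup>2)\<close>. By induction, \<open>dom (A\<^sup>k)\<close> is spanned by its positive elements up to
  elements of \<open>dom (A\<^sup>k\<^sup>+\<^sup>1)\<close>.\<close>

lemma dom_power_spanned_by_positive:
  assumes pos: "individually_eventually_positive l0 D A"
    and V: "complexification.subspace V" "dom_power D A (Suc k) \<subseteq> V"
      "\<And>g. 0 \<le> g \<Longrightarrow> g \<in> dom_power D A k \<Longrightarrow> g \<in> V"
  shows "dom_power D A k \<subseteq> V"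
  using V
proof (induction k arbitrary: V)
  case 0
  thus ?case using complex_subspace_contains_all by auto
next
  case (Suc k)
  obtain a where a: "a \<in> \<rho>" using eventually_positive_imp_resolvent_point[OF pos] .
  have "dom_power D A k \<subseteq> R a -` V"
  proof (rule Suc.IH)
    show "complexification.subspace (R a -` V)" by (rule subspace_vimage_R[OF a Suc.prems(1)])
    show "dom_power D A (Suc k) \<subseteq> R a -` V"
      using Suc.prems(2) R_mem_dom_power_Suc[OF a] by blast
    fix g assume g: "0 \<le> g" "g \<in> dom_power D A k"
    have "\<forall>\<^sub>F l in at l0. complex_of_real l \<in> \<rho> \<and> 0 \<le> (l - l0) *\<^sub>R R (complex_of_real l) g \<and> l \<noteq> l0"
      using pos g(1) unfolding individually_eventually_positive_def
      by (auto simp: eventually_conj_iff eventually_neq_at_within)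
    from eventually_happens'[OF at_neq_bot this] obtain l
      where l: "complex_of_real l \<in> \<rho>" "0 \<le> (l - l0) *\<^sub>R R (complex_of_real l) g" "l \<noteq> l0" by blast
    let ?r = "R (complex_of_real l)"
    have "?r g \<in> dom_power D A (Suc k)" by (rule R_mem_dom_power_Suc[OF l(1) g(2)])
    hence "complex_of_real (l - l0) *\<^sub>C ?r g \<in> dom_power D A (Suc k)"
      by (intro complexification.subspace_scale subspace_dom_power)
    hence "(l - l0) *\<^sub>R ?r g \<in> dom_power D A (Suc k)" by (simp only: scaleC_of_real)
    with l(2) have "(l - l0) *\<^sub>R ?r g \<in> V" by (rule Suc.prems(3))
    hence "complex_of_real (inverse (l - l0)) *\<^sub>C (l - l0) *\<^sub>R ?r g \<in> V"
      by (intro complexification.subspace_scale Suc.prems(1))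
    hence "?r g \<in> V" using l(3) by (simp only: scaleC_of_real) simp
    moreover have "R a (?r g) \<in> V"
      using Suc.prems(2) R_mem_dom_power_Suc[OF a] R_mem_dom_power_Suc[OF l(1) g(2)] by blast
    ultimately show "g \<in> R a -` V"
      unfolding vimage_eq resolvent_identity[OF a l(1), of g]
      by (intro complexification.subspace_add complexification.subspace_scale Suc.prems(1))
  qed
  thus ?case unfolding dom_power_Suc_eq_range[OF a] by blast
qed

text \<open>Write \<open>T(l) = (l - l0) R(l)\<close>. For \<open>m < l0 < l\<close> the resolvent identity exhibits \<open>T(m) T(l)\<close> as
  a convex combination of \<open>T(l)\<close> and \<open>T(m)\<close>. If both map \<open>g\<close> into the cone, then \<open>T(l) g\<close> is at
  most a multiple of \<open>T(m) T(l) g\<close>, which is smoother by one power of \<open>A\<close>.\<close>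

lemma eventual_positivity_improves_domain:
  assumes pos: "individually_eventually_positive l0 D A"
    and u: "0 \<le> u" and sub: "dom_power D A (Suc (Suc n)) \<subseteq> principal_ideal u"
  shows "dom_power D A (Suc n) \<subseteq> principal_ideal u"
proof -
  note S = principal_ideal_subspace[OF u]
  obtain a where a: "a \<in> \<rho>" using eventually_positive_imp_resolvent_point[OF pos] .
  have "dom_power D A n \<subseteq> R a -` principal_ideal u"
  proof (rule dom_power_spanned_by_positive[OF pos])
    show "complexification.subspace (R a -` principal_ideal u)" by (rule subspace_vimage_R[OF a S])
    show "dom_power D A (Suc n) \<subseteq> R a -` principal_ideal u"
      using sub R_mem_dom_power_Suc[OF a] by blast
    fix g assume g: "0 \<le> g" "g \<in> dom_power D A n"
    let ?P = "\<lambda>l. complex_of_real l \<in> \<rho> \<and> 0 \<le> (l - l0) *\<^sub>R R (complex_of_real l) g"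
    have ev: "\<forall>\<^sub>F l in at l0. ?P l"
      using pos g(1) unfolding individually_eventually_positive_def by simp
    have "\<forall>\<^sub>F l in at_right l0. l0 < l" "\<forall>\<^sub>F m in at_left l0. m < l0"
      by (simp_all add: eventually_at_filter)
    moreover have "\<forall>\<^sub>F l in at_right l0. ?P l" "\<forall>\<^sub>F m in at_left l0. ?P m"
      using ev unfolding eventually_at_split by blast+
    ultimately have "\<forall>\<^sub>F l in at_right l0. l0 < l \<and> ?P l" "\<forall>\<^sub>F m in at_left l0. m < l0 \<and> ?P m"
      by (auto simp: eventually_conj_iff)
    from this[THEN eventually_happens'[rotated]] obtain l m
      where l: "l0 < l" "?P l" and m: "m < l0" "?P m"
      using trivial_limit_at_right_real trivial_limit_at_left_real by blast
    let ?Rl = "R (complex_of_real l)" and ?Rm = "R (complex_of_real m)"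
    define h where "h = (l - l0) *\<^sub>R ?Rl g"
    have "?Rm g = ?Rl g + (l - m) *\<^sub>R ?Rm (?Rl g)"
      using resolvent_identity_real[of m l g] l m by blast
    hence eq: "(l - m) *\<^sub>R ?Rm (?Rl g) = ?Rm g - ?Rl g" by simp
    have combination: "((m - l0) * (l - l0)) *\<^sub>R (l - m) *\<^sub>R ?Rm (?Rl g)
        = (l0 - m) *\<^sub>R h + (l - l0) *\<^sub>R (m - l0) *\<^sub>R ?Rm g"
      unfolding eq by (simp add: h_def algebra_simps)
    have "0 \<le> (l - l0) *\<^sub>R (m - l0) *\<^sub>R ?Rm g"
      using l m by (intro scaleR_nonneg_nonneg[of "l - l0" "(m - l0) *\<^sub>R ?Rm g"]) simp_all
    hence "(l0 - m) *\<^sub>R h \<le> ((m - l0) * (l - l0)) *\<^sub>R (l - m) *\<^sub>R ?Rm (?Rl g)"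
      unfolding combination by simp
    hence "inverse (l0 - m) *\<^sub>R (l0 - m) *\<^sub>R h
        \<le> inverse (l0 - m) *\<^sub>R ((m - l0) * (l - l0)) *\<^sub>R (l - m) *\<^sub>R ?Rm (?Rl g)"
      using m by (intro scaleR_left_mono) auto
    hence "h \<le> (inverse (l0 - m) * ((m - l0) * (l - l0)) * (l - m)) *\<^sub>R ?Rm (?Rl g)"
      using m by (simp add: mult.assoc)
    moreover have "?Rm (?Rl g) \<in> principal_ideal u"
      using sub l m g(2) R_mem_dom_power_Suc by blast
    hence "complex_of_real c *\<^sub>C ?Rm (?Rl g) \<in> principal_ideal u" for c
      by (rule complexification.subspace_scale[OF S])
    hence "c *\<^sub>R ?Rm (?Rl g) \<in> principal_ideal u" for c unfolding scaleC_of_real .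
    moreover have "0 \<le> h" using l by (simp add: h_def)
    ultimately have "h \<in> principal_ideal u" using principal_ideal_solid[OF u] by blast
    hence "complex_of_real (inverse (l - l0)) *\<^sub>C h \<in> principal_ideal u"
      by (rule complexification.subspace_scale[OF S])
    hence "?Rl g \<in> principal_ideal u" using l by (simp only: scaleC_of_real h_def) simp
    moreover have "R a (?Rl g) \<in> principal_ideal u"
      using sub l a g(2) R_mem_dom_power_Suc by blast
    ultimately have "?Rl g + (complex_of_real l - a) *\<^sub>C R a (?Rl g) \<in> principal_ideal u"
      by (intro complexification.subspace_add[OF S] complexification.subspace_scale[OF S])
    thus "g \<in> R a -` principal_ideal u"
      using resolvent_identity[OF a, of "complex_of_real l" g] l by simp
  qed
  thus ?thesis unfolding dom_power_Suc_eq_range[OF a] by blast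
qed

corollary eventual_positivity_imp_domain_subset:
  assumes "individually_eventually_positive l0 D A"
    and "0 \<le> u" and "dom_power D A n \<subseteq> principal_ideal u"
  shows "D \<subseteq> principal_ideal u"
proof -
  \<comment> \<open>The improvement step stops at exponent one, so start the descent there also when \<open>n = 0\<close>.\<close>
  have "dom_power D A (Suc n) \<subseteq> principal_ideal u"
    using assms(3) dom_power_Suc_subset by blast
  hence "dom_power D A (Suc 0) \<subseteq> principal_ideal u"
    by (induction n) (use eventual_positivity_improves_domain[OF assms(1,2)] in blast)+
  thus ?thesis by simp
qed

end

section \<open>Leading coefficient at a pole\<close>

text \<open>Convergence at some \<open>r\<close> bounds the terms there, so for smaller \<open>s\<close> the tail of the series is
  dominated by a geometric series of size \<open>O(\<bar>s\<bar>)\<close>.\<close>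

lemma series_tendsto_constant_term:
  fixes a :: "nat \<Rightarrow> 'b :: banach"
  assumes \<epsilon>: "\<epsilon> > 0"
    and sums: "\<And>s. 0 < \<bar>s\<bar> \<Longrightarrow> \<bar>s\<bar> < \<epsilon> \<Longrightarrow> (\<lambda>j. s ^ j *\<^sub>R a j) sums g s"
  shows "(g \<longlongrightarrow> a 0) (at 0)"
proof -
  define r where "r = \<epsilon> / 2"
  have r: "0 < r" "r < \<epsilon>" using \<epsilon> by (auto simp: r_def)
  have "(\<lambda>j. r ^ j *\<^sub>R a j) \<longlonglongrightarrow> 0"
    using sums[of r] r by (intro summable_LIMSEQ_zero) (auto simp: sums_iff)
  hence "Bseq (\<lambda>j. r ^ j *\<^sub>R a j)" by (intro convergent_imp_Bseq convergentI)
  then obtain M where M: "M > 0" "\<And>j. norm (r ^ j *\<^sub>R a j) \<le> M" by (auto elim: BseqE)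
  have bound: "norm (g s - a 0) \<le> 2 * M / r * \<bar>s\<bar>" if s: "0 < \<bar>s\<bar>" "\<bar>s\<bar> < r / 2" for s
  proof -
    have "(\<lambda>j. s ^ Suc j *\<^sub>R a (Suc j)) sums (g s - a 0)"
      using sums[of s] s r sums_split_initial_segment[of "\<lambda>j. s ^ j *\<^sub>R a j" "g s" 1] by simp
    hence eq: "g s - a 0 = (\<Sum>j. s ^ Suc j *\<^sub>R a (Suc j))" by (simp add: sums_iff)
    have le: "norm (s ^ Suc j *\<^sub>R a (Suc j)) \<le> M * (\<bar>s\<bar> / r) * (1 / 2) ^ j" for j
    proof -
      have "norm (s ^ Suc j *\<^sub>R a (Suc j)) = (\<bar>s\<bar> / r) ^ Suc j * norm (r ^ Suc j *\<^sub>R a (Suc j))"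
        using r by (simp add: power_abs power_divide del: power_Suc)
      also have "\<dots> \<le> (\<bar>s\<bar> / r) ^ Suc j * M"
        using r s by (intro mult_left_mono M) auto
      also have "\<dots> = M * (\<bar>s\<bar> / r) * (\<bar>s\<bar> / r) ^ j" by simp
      also have "\<dots> \<le> M * (\<bar>s\<bar> / r) * (1 / 2) ^ j"
        using r s M by (intro mult_left_mono power_mono) (auto simp: field_simps)
      finally show ?thesis .
    qed
    have "norm (g s - a 0) \<le> (\<Sum>j. M * (\<bar>s\<bar> / r) * (1 / 2) ^ j)"
      unfolding eq by (intro norm_suminf_le le summable_mult) (simp add: summable_geometric)
    also have "\<dots> = 2 * M / r * \<bar>s\<bar>"
      using r suminf_mult[OF summable_geometric[of "1 / 2 :: real"], of "M * (\<bar>s\<bar> / r)"]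
        suminf_geometric[of "1 / 2 :: real"] by simp
    finally show ?thesis .
  qed
  have "((\<lambda>s. g s - a 0) \<longlongrightarrow> 0) (at 0)"
  proof (rule Lim_null_comparison)
    show "\<forall>\<^sub>F s in at 0. norm (g s - a 0) \<le> 2 * M / r * \<bar>s\<bar>"
      unfolding eventually_at using bound r by (intro exI[of _ "r / 2"]) (auto simp: dist_real_def)
    show "((\<lambda>s. 2 * M / r * \<bar>s\<bar>) \<longlongrightarrow> 0) (at (0 :: real))"
      by (rule tendsto_mult_right_zero[OF tendsto_rabs_zero[OF tendsto_ident_at]])
  qed
  thus ?thesis by (simp add: LIM_zero_iff)
qed

text \<open>Here \<open>p\<close> is the order of the pole and \<open>U\<close> the leading coefficient of the Laurent expansion, for
  \<open>p = 1\<close> the spectral projection. The argument sees the expansion only through the limit that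
  defines \<open>U\<close>, taken along the real axis.\<close>

locale resolvent_pole = complex_linear_operator D A
  for D :: "'a :: banach_lattice complexification set"
    and A :: "'a complexification \<Rightarrow> 'a complexification" +
  fixes l0 :: real and p :: nat and U :: "'a complexification \<Rightarrow> 'a complexification"
  assumes p: "1 \<le> p"
    and bounded_linear_U: "bounded_linear U"
    and U_scaleC: "U (c *\<^sub>C f) = c *\<^sub>C U f"
    and U_nonzero: "U \<noteq> (\<lambda>f. 0)"
    and eventually_resolvent: "\<forall>\<^sub>F l in at l0. complex_of_real l \<in> resolvent_set D A"
    and tendsto_U:
      "((\<lambda>l. (l - l0) ^ p *\<^sub>R resolvent (complex_of_real l) D A f) \<longlongrightarrow> U f) (at l0)"

text \<open>Multiplication by \<open>(l - l0)\<^sup>p\<close> turns the Laurent expansion at \<open>l0\<close> into a power series, and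
  convergence in operator norm gives convergence at every \<open>f\<close>.\<close>

lemma (in complex_linear_operator) pole_of_resolvent_imp_resolvent_pole:
  assumes "pole_of_resolvent (complex_of_real l0) D A"
  obtains p U where "resolvent_pole D A l0 p U"
proof -
  from assms obtain p U \<epsilon> where p: "p \<ge> 1" and \<epsilon>: "\<epsilon> > 0"
    and U: "\<And>j. bounded_linear (U j)" "\<And>j c x. U j (c *\<^sub>C x) = c *\<^sub>C U j x" "U 0 \<noteq> (\<lambda>x. 0)"
    and mem: "\<And>l. 0 < cmod (l - complex_of_real l0) \<Longrightarrow> cmod (l - complex_of_real l0) < \<epsilon> \<Longrightarrow> l \<in> \<rho>"
    and lim: "\<And>l. 0 < cmod (l - complex_of_real l0) \<Longrightarrow> cmod (l - complex_of_real l0) < \<epsilon> \<Longrightarrow>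
      (\<lambda>N. onorm (\<lambda>x. R l x - (\<Sum>j<N. ((l - complex_of_real l0) powi (int j - int p)) *\<^sub>C U j x)))
        \<longlonglongrightarrow> 0"
    unfolding pole_of_resolvent_def by blast
  have cmod_real: "cmod (complex_of_real (l0 + s) - complex_of_real l0) = \<bar>s\<bar>" for s
    by simp
  have series: "(\<lambda>j. s ^ j *\<^sub>R U j f) sums (s ^ p *\<^sub>R R (complex_of_real (l0 + s)) f)"
    if s: "0 < \<bar>s\<bar>" "\<bar>s\<bar> < \<epsilon>" for s f
  proof -
    let ?l = "complex_of_real (l0 + s)"
    let ?S = "\<lambda>N x. \<Sum>j<N. (complex_of_real s powi (int j - int p)) *\<^sub>C U j x"
    have l: "?l \<in> \<rho>" using mem[of ?l] s unfolding cmod_real by blast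
    have "(\<lambda>N. onorm (\<lambda>x. R ?l x - ?S N x)) \<longlonglongrightarrow> 0"
      using lim[of ?l] s unfolding cmod_real by simp
    hence lim0: "(\<lambda>N. onorm (\<lambda>x. R ?l x - ?S N x) * norm f) \<longlonglongrightarrow> 0"
      by (rule tendsto_mult_left_zero)
    have "bounded_linear (\<lambda>x. R ?l x - ?S N x)" for N
      by (intro bounded_linear_sub bounded_linear_sum bounded_linear_R l
          bounded_linear_compose[OF bounded_linear_scaleC] U(1))
    hence "norm (R ?l f - ?S N f) \<le> onorm (\<lambda>x. R ?l x - ?S N x) * norm f" for N
      by (rule onorm)
    hence "(\<lambda>N. R ?l f - ?S N f) \<longlonglongrightarrow> 0"
      by (intro Lim_null_comparison[OF always_eventually lim0] allI)
    from tendsto_diff[OF tendsto_const[of "R ?l f"] this]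
    have "(\<lambda>N. ?S N f) \<longlonglongrightarrow> R ?l f" by simp
    from tendsto_scaleR[OF tendsto_const this]
    have "(\<lambda>N. s ^ p *\<^sub>R ?S N f) \<longlonglongrightarrow> s ^ p *\<^sub>R R ?l f" .
    moreover have "s ^ p *\<^sub>R ?S N f = (\<Sum>j<N. s ^ j *\<^sub>R U j f)" for N
    proof -
      have "s ^ p *\<^sub>R (complex_of_real s powi (int j - int p)) *\<^sub>C U j f = s ^ j *\<^sub>R U j f" for j
      proof -
        have "complex_of_real (s ^ p) * complex_of_real s powi (int j - int p)
            = complex_of_real (s ^ j)"
          using s by (simp add: power_int_diff)
        thus ?thesis
          by (metis complexification.scale_scale scaleC_of_real)
      qed
      thus ?thesis by (simp add: scaleR_sum_right)
    qed
    ultimately show ?thesis unfolding sums_def by simp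
  qed
  have near: "\<forall>\<^sub>F l in at l0. complex_of_real l \<in> \<rho>"
    unfolding eventually_at
  proof (intro exI[of _ \<epsilon>] conjI ballI impI \<epsilon>)
    fix l assume "l \<noteq> l0 \<and> dist l l0 < \<epsilon>"
    thus "complex_of_real l \<in> \<rho>"
      using cmod_real[of "l - l0"] by (intro mem) (simp_all add: dist_real_def)
  qed
  have tends: "((\<lambda>l. (l - l0) ^ p *\<^sub>R R (complex_of_real l) f) \<longlongrightarrow> U 0 f) (at l0)" for f
  proof -
    have "((\<lambda>s. s ^ p *\<^sub>R R (complex_of_real (l0 + s)) f) \<longlongrightarrow> U 0 f) (at 0)"
      by (rule series_tendsto_constant_term[OF \<epsilon> series])
    thus ?thesis using LIM_offset_zero_cancel[of "\<lambda>l. (l - l0) ^ p *\<^sub>R R (complex_of_real l) f" l0]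
      by simp
  qed
  have "resolvent_pole D A l0 p (U 0)"
    using complex_linear_operator_axioms
    by (rule resolvent_pole.intro) (intro resolvent_pole_axioms.intro p U near tends)
  thus thesis by (rule that)
qed

context resolvent_pole
begin

lemma U_linear_simps: "U (f + g) = U f + U g" "U (r *\<^sub>R f) = r *\<^sub>R U f" "U 0 = 0" "U (f - g) = U f - U g"
  using bounded_linear_U by (simp_all add: linear_simps)

lemma obtain_resolvent_point:
  assumes "\<forall>\<^sub>F l in at l0. Q l"
  obtains l where "complex_of_real l \<in> \<rho>" "Q l" "l \<noteq> l0"
proof -
  have "\<forall>\<^sub>F l in at l0. complex_of_real l \<in> \<rho> \<and> Q l \<and> l \<noteq> l0"
    using eventually_resolvent assms by (auto simp: eventually_conj_iff eventually_neq_at_within)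
  from eventually_happens'[OF at_neq_bot this] show thesis using that by blast
qed

lemma R_U_commute:
  assumes "m \<in> \<rho>"
  shows "R m (U f) = U (R m f)"
proof -
  interpret Rm: bounded_linear "R m" by (rule bounded_linear_R[OF assms])
  have "((\<lambda>l. R m ((l - l0) ^ p *\<^sub>R R (complex_of_real l) f)) \<longlongrightarrow> R m (U f)) (at l0)"
    by (intro Rm.tendsto tendsto_U)
  moreover have "\<forall>\<^sub>F l in at l0. R m ((l - l0) ^ p *\<^sub>R R (complex_of_real l) f)
      = (l - l0) ^ p *\<^sub>R R (complex_of_real l) (R m f)"
    using eventually_resolvent by eventually_elim (simp add: Rm.scaleR resolvent_commute[OF assms])
  ultimately have "((\<lambda>l. (l - l0) ^ p *\<^sub>R R (complex_of_real l) (R m f)) \<longlongrightarrow> R m (U f)) (at l0)"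
    by (rule Lim_transform_eventually)
  thus ?thesis using tendsto_U by (rule tendsto_unique[OF at_neq_bot])
qed

text \<open>Multiply the resolvent identity for \<open>R(l)\<close> and \<open>R(m)\<close> by \<open>(l - l0)\<^sup>p\<close> and let \<open>l\<close> tend to
  \<open>l0\<close>: this gives \<open>(m - l0) R(m) U f = U f\<close>.\<close>

lemma U_in_eigenspace: "U f \<in> eigenspace (complex_of_real l0) D A"
proof -
  obtain m where m: "complex_of_real m \<in> \<rho>"
    using obtain_resolvent_point[of "\<lambda>_. True"] by auto
  let ?Rm = "R (complex_of_real m)"
  interpret Rm: bounded_linear ?Rm by (rule bounded_linear_R[OF m])
  let ?g = "\<lambda>l. (l - l0) ^ p *\<^sub>R R (complex_of_real l) f"
  have "((\<lambda>l. ?g l - (l - l0) ^ p *\<^sub>R ?Rm f) \<longlongrightarrow> U f - (l0 - l0) ^ p *\<^sub>R ?Rm f) (at l0)"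
    by (intro tendsto_intros tendsto_U)
  moreover have "\<forall>\<^sub>F l in at l0. ?g l - (l - l0) ^ p *\<^sub>R ?Rm f = (m - l) *\<^sub>R ?Rm (?g l)"
    using eventually_resolvent
  proof eventually_elim
    case (elim l)
    have "R (complex_of_real l) f - ?Rm f = (m - l) *\<^sub>R ?Rm (R (complex_of_real l) f)"
      using resolvent_identity_real[OF elim m, of f] unfolding resolvent_commute[OF elim m]
      by (metis add_diff_cancel_left')
    thus ?case
      unfolding scaleR_diff_right[symmetric] by (simp add: Rm.scaleR mult.commute)
  qed
  ultimately have "((\<lambda>l. (m - l) *\<^sub>R ?Rm (?g l)) \<longlongrightarrow> U f - (l0 - l0) ^ p *\<^sub>R ?Rm f) (at l0)"
    by (rule Lim_transform_eventually)
  moreover have "((\<lambda>l. (m - l) *\<^sub>R ?Rm (?g l)) \<longlongrightarrow> (m - l0) *\<^sub>R ?Rm (U f)) (at l0)"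
    by (intro tendsto_intros Rm.tendsto tendsto_U)
  ultimately have "U f - (l0 - l0) ^ p *\<^sub>R ?Rm f = (m - l0) *\<^sub>R ?Rm (U f)"
    by (rule tendsto_unique[OF at_neq_bot])
  hence "complex_of_real (m - l0) *\<^sub>C ?Rm (U f) = U f"
    using p unfolding scaleC_of_real by (cases p) simp_all
  thus ?thesis by (intro eigenvectorI[OF m]) simp
qed

lemma T_eigenvector:
  assumes "complex_of_real l \<in> \<rho>" "x \<in> eigenspace (complex_of_real l0) D A"
  shows "(l - l0) *\<^sub>R R (complex_of_real l) x = x"
  using R_eigenvector[OF assms] unfolding of_real_diff[symmetric] scaleC_of_real .

text \<open>For an eigenvector \<open>x\<close> the function \<open>(l - l0)\<^sup>p R(l) x\<close> is \<open>(l - l0)\<^sup>p\<^sup>-\<^sup>1 x\<close>. The power of zero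
  below is \<open>1\<close> for a simple pole and \<open>0\<close> otherwise.\<close>

lemma U_eigenvector:
  assumes "x \<in> eigenspace (complex_of_real l0) D A"
  shows "U x = 0 ^ (p - 1) *\<^sub>R x"
proof -
  have "\<forall>\<^sub>F l in at l0. (l - l0) ^ p *\<^sub>R R (complex_of_real l) x = (l - l0) ^ (p - 1) *\<^sub>R x"
    using eventually_resolvent
  proof eventually_elim
    case (elim l)
    have "(l - l0) ^ p = (l - l0) ^ (p - 1) * (l - l0)" using p by (simp flip: power_Suc2)
    thus ?case using T_eigenvector[OF elim assms] by (simp flip: scaleR_scaleR)
  qed
  with tendsto_U have "((\<lambda>l. (l - l0) ^ (p - 1) *\<^sub>R x) \<longlongrightarrow> U x) (at l0)"
    by (rule Lim_transform_eventually)
  moreover have "((\<lambda>l. (l - l0) ^ (p - 1) *\<^sub>R x) \<longlongrightarrow> (l0 - l0) ^ (p - 1) *\<^sub>R x) (at l0)"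
    by (intro tendsto_intros)
  ultimately have "U x = (l0 - l0) ^ (p - 1) *\<^sub>R x" by (rule tendsto_unique[OF at_neq_bot])
  thus ?thesis by simp
qed

text \<open>The limit from the right suffices, where \<open>(l - l0)\<^sup>p\<^sup>-\<^sup>1\<close> is positive.\<close>

lemma U_nonneg:
  assumes "individually_eventually_positive l0 D A" "0 \<le> f"
  shows "0 \<le> U f"
proof (rule tendsto_nonneg_complexification)
  show "((\<lambda>l. (l - l0) ^ p *\<^sub>R R (complex_of_real l) f) \<longlongrightarrow> U f) (at_right l0)"
    using tendsto_U by (rule tendsto_mono[rotated]) (simp add: at_le)
  have "\<forall>\<^sub>F l in at_right l0. 0 \<le> (l - l0) *\<^sub>R R (complex_of_real l) f"
    using assms unfolding individually_eventually_positive_def eventually_at_split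
    by (auto elim: eventually_mono)
  moreover have "\<forall>\<^sub>F l in at_right l0. l0 < l" by (simp add: eventually_at_filter)
  ultimately show "\<forall>\<^sub>F l in at_right l0. 0 \<le> (l - l0) ^ p *\<^sub>R R (complex_of_real l) f"
  proof eventually_elim
    case (elim l)
    have "(l - l0) ^ p = (l - l0) ^ (p - 1) * (l - l0)" using p by (simp flip: power_Suc2)
    thus ?case using elim scaleR_nonneg_nonneg[OF _ elim(1), of "(l - l0) ^ (p - 1)"] by simp
  qed
qed simp

lemma U_nonzero_at_positive: "\<exists>f\<ge>0. U f \<noteq> 0"
proof (rule ccontr)
  assume neg: "\<not> ?thesis"
  have "complexification.subspace {f. U f = 0}"
    by (auto intro!: complexification.subspaceI simp: U_linear_simps U_scaleC)
  hence "f \<in> {f. U f = 0}" for f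
    by (rule complex_subspace_contains_all) (use neg in auto)
  thus False using U_nonzero by auto
qed

end

section \<open>Operators into the principal ideal\<close>

lemma modulus_le_iff: "modulus z \<le> m \<longleftrightarrow> (\<forall>\<theta>. cos \<theta> *\<^sub>R re z + sin \<theta> *\<^sub>R im z \<le> m)"
  using modulus_upper modulus_least order_trans by meson

lemma closed_modulus_le:
  fixes S :: "'b :: real_normed_vector \<Rightarrow> 'a :: banach_lattice complexification"
  assumes "bounded_linear S"
  shows "closed {f. modulus (S f) \<le> m}"
proof -
  have "{f. modulus (S f) \<le> m}
      = (\<Inter>\<theta>. (\<lambda>f. m - (cos \<theta> *\<^sub>R re (S f) + sin \<theta> *\<^sub>R im (S f))) -` {x. 0 \<le> x})"
    by (auto simp: modulus_le_iff)
  moreover have "closed ((\<lambda>f. m - (cos \<theta> *\<^sub>R re (S f) + sin \<theta> *\<^sub>R im (S f))) -` {x. 0 \<le> x})" for \<theta>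
    by (intro closed_vimage closed_nonneg continuous_intros
        bounded_linear.continuous_on[OF bounded_linear_re]
        bounded_linear.continuous_on[OF bounded_linear_im] linear_continuous_on assms)
  ultimately show ?thesis by (simp add: closed_INT)
qed

text \<open>The space \<open>E\<close> is the union of the closed sets on which the modulus of \<open>S f\<close> is at most \<open>k u\<close>.
  By Baire's theorem one of them contains a ball, and linearity spreads the bound from there. So
  \<open>S\<close> is bounded for the gauge norm of \<open>E\<^sub>u\<close>.\<close>

lemma bounded_operator_into_principal_ideal:
  fixes S :: "'a :: banach_lattice complexification \<Rightarrow> 'a complexification"
  assumes S: "bounded_linear S" and u: "0 \<le> u" and range: "\<And>f. S f \<in> principal_ideal u"
  obtains C where "C > 0" "\<And>f. modulus (S f) \<le> (C * norm f) *\<^sub>R re u"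
proof -
  interpret bounded_linear S by fact
  have ru: "0 \<le> re u" using u by (simp add: less_eq_complexification_def)
  define F where "F k = {f. modulus (S f) \<le> real k *\<^sub>R re u}" for k :: nat
  have "\<exists>k. f \<in> F k" for f
  proof -
    obtain c where c: "modulus (S f) \<le> c *\<^sub>R re u"
      using range[of f] mem_principal_ideal_iff[OF u, of "S f"] by blast
    also have "\<dots> \<le> real (nat \<lceil>c\<rceil>) *\<^sub>R re u"
      using ru by (intro scaleR_right_mono) linarith+
    finally show ?thesis by (auto simp: F_def)
  qed
  hence cover: "\<Union> (range F) = UNIV" by blast
  have "\<exists>k. interior (F k) \<noteq> {}"
  proof (rule ccontr)
    assume "\<not> ?thesis"
    hence empty: "interior (F k) = {}" for k by blast
    have "euclidean closure_of (\<Inter> (range (\<lambda>k. - F k))) = topspace euclidean"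
    proof (rule Baire_category)
      show "completely_metrizable_space (euclidean :: 'a complexification topology) \<or>
          locally_compact_space (euclidean :: 'a complexification topology) \<and>
          regular_space (euclidean :: 'a complexification topology)"
        by (simp add: completely_metrizable_space_euclidean)
      show "openin euclidean T \<and> euclidean closure_of T = topspace euclidean"
        if "T \<in> range (\<lambda>k. - F k)" for T
        using that closed_modulus_le[OF S] empty
        by (auto simp: F_def closure_complement open_Compl)
    qed simp
    moreover have "\<Inter> (range (\<lambda>k. - F k)) = {}" using cover by blast
    ultimately show False by simp
  qed
  then obtain k g r where r: "r > 0" "ball g r \<subseteq> F k"
    by (meson ex_in_conv mem_interior)
  have bound: "modulus (S h) \<le> (2 * real k) *\<^sub>R re u" if "norm h < r" for h
  proof -
    have "g + h \<in> F k" "g \<in> F k" using r that by (auto simp: dist_norm subset_iff)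
    hence *: "modulus (S (g + h)) \<le> real k *\<^sub>R re u" "modulus (S g) \<le> real k *\<^sub>R re u"
      by (auto simp: F_def)
    have "modulus (S h) = modulus (S (g + h) + (- 1) *\<^sub>C S g)" by (simp add: add)
    also have "\<dots> \<le> modulus (S (g + h)) + modulus ((- 1) *\<^sub>C S g)" by (rule modulus_triangle)
    also have "\<dots> \<le> real k *\<^sub>R re u + real k *\<^sub>R re u"
      using * modulus_scaleC[of "- 1" "S g"] by (intro add_mono) simp_all
    finally show ?thesis by (simp flip: scaleR_add_left)
  qed
  \<comment> \<open>Scaling \<open>f\<close> to norm \<open>r / 2\<close> costs the factor \<open>2 norm f / r\<close>; the summand one keeps \<open>C\<close>
    positive when \<open>k = 0\<close>.\<close>
  define C where "C = 4 * (real k + 1) / r"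
  have "modulus (S f) \<le> (C * norm f) *\<^sub>R re u" for f
  proof (cases "f = 0")
    case False
    define t where "t = r / (2 * norm f)"
    have t: "t > 0" using r False by (simp add: t_def)
    have "norm (t *\<^sub>R f) < r" using r False by (simp add: t_def)
    hence "modulus (S (t *\<^sub>R f)) \<le> (2 * real k) *\<^sub>R re u" by (rule bound)
    moreover have "modulus (S (t *\<^sub>R f)) = t *\<^sub>R modulus (S f)"
      using modulus_scaleC[of "complex_of_real t" "S f"] t by (simp add: scaleR)
    ultimately have "inverse t *\<^sub>R t *\<^sub>R modulus (S f) \<le> inverse t *\<^sub>R (2 * real k) *\<^sub>R re u"
      using t by (intro scaleR_left_mono) auto
    hence "modulus (S f) \<le> (inverse t * (2 * real k)) *\<^sub>R re u" using t by simp
    also have "\<dots> \<le> (C * norm f) *\<^sub>R re u"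
      using r False by (intro scaleR_right_mono ru) (simp add: t_def C_def field_simps)
    finally show ?thesis .
  qed (simp add: zero modulus_real)
  moreover have "C > 0" using r by (simp add: C_def)
  ultimately show thesis by (rule that[rotated])
qed

section \<open>Dual eigenvectors\<close>

text \<open>Density of the domain makes the functional in the definition of the dual operator unique.\<close>

lemma dual_op_eqI:
  assumes dense: "densely_defined D" and \<psi>: "\<psi> \<in> dual_space" "\<forall>x\<in>D. \<phi> (A x) = \<psi> x"
  shows "dual_op D A \<phi> = \<psi>"
  unfolding dual_op_def
proof (rule the_equality)
  show "\<psi> \<in> dual_space \<and> (\<forall>x\<in>D. \<phi> (A x) = \<psi> x)" using \<psi> by blast
  fix \<psi>' assume \<psi>': "\<psi>' \<in> dual_space \<and> (\<forall>x\<in>D. \<phi> (A x) = \<psi>' x)"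
  have "closed {x. \<psi>' x = \<psi> x}"
    using \<psi>(1) \<psi>' by (intro closed_Collect_eq linear_continuous_on) (auto simp: dual_space_def)
  moreover have "D \<subseteq> {x. \<psi>' x = \<psi> x}" using \<psi>(2) \<psi>' by auto
  ultimately have "closure D \<subseteq> {x. \<psi>' x = \<psi> x}" by (intro closure_minimal)
  thus "\<psi>' = \<psi>" using dense by (auto simp: densely_defined_def)
qed

lemma mem_dual_eigenspace_iff:
  assumes "densely_defined D"
  shows "\<phi> \<in> dual_eigenspace l D A \<longleftrightarrow> \<phi> \<in> dual_space \<and> (\<forall>x\<in>D. \<phi> (A x) = l * \<phi> x)"
proof (intro iffI conjI)
  assume \<phi>: "\<phi> \<in> dual_eigenspace l D A"
  thus "\<phi> \<in> dual_space" by (simp add: dual_eigenspace_def dual_dom_def)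
  from \<phi> obtain \<psi> where \<psi>: "\<psi> \<in> dual_space" "\<forall>x\<in>D. \<phi> (A x) = \<psi> x"
    by (auto simp: dual_eigenspace_def dual_dom_def)
  have "dual_op D A \<phi> = \<psi>" using assms \<psi> by (rule dual_op_eqI)
  thus "\<forall>x\<in>D. \<phi> (A x) = l * \<phi> x" using \<phi> \<psi> by (simp add: dual_eigenspace_def)
next
  assume \<phi>: "\<phi> \<in> dual_space \<and> (\<forall>x\<in>D. \<phi> (A x) = l * \<phi> x)"
  hence "(\<lambda>x. l * \<phi> x) \<in> dual_space"
    by (auto simp: dual_space_def bounded_linear_const_mult)
  with \<phi> have "dual_op D A \<phi> = (\<lambda>x. l * \<phi> x)" "\<phi> \<in> dual_dom D A"
    by (auto intro!: dual_op_eqI[OF assms] simp: dual_dom_def)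
  thus "\<phi> \<in> dual_eigenspace l D A" by (simp add: dual_eigenspace_def)
qed

context resolvent_pole
begin

section \<open>Strong positivity implies the spectral assumption\<close>

text \<open>An eigenvector is fixed by \<open>(l - l0) R(l)\<close>, so strong positivity applies to the eigenvector
  itself.\<close>

lemma eigenvector_dominates:
  assumes strong: "individually_strongly_positive l0 D A u"
    and x: "0 < x" "x \<in> eigenspace (complex_of_real l0) D A"
  shows "x \<succeq> u"
proof -
  have "\<forall>\<^sub>F l in at l0. (l - l0) *\<^sub>R R (complex_of_real l) x \<succeq> u"
    using strong x(1) by (auto simp: individually_strongly_positive_def elim: eventually_mono)
  then obtain l where "complex_of_real l \<in> \<rho>" "(l - l0) *\<^sub>R R (complex_of_real l) x \<succeq> u"
    by (rule obtain_resolvent_point)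
  thus ?thesis using T_eigenvector x(2) by simp
qed

text \<open>By positivity, \<open>U\<close> would otherwise vanish at \<open>u\<close> and hence everywhere.\<close>

lemma U_nonzero_at_dominating:
  assumes u: "quasi_interior u" and pos: "individually_eventually_positive l0 D A" and g: "g \<succeq> u"
  shows "U g \<noteq> 0"
proof
  assume "U g = 0"
  from g obtain c where c: "c > 0" "c *\<^sub>R u \<le> g" by (auto simp: dominates_def)
  have "0 \<le> U (g - c *\<^sub>R u)" using c by (intro U_nonneg[OF pos]) simp
  hence "c *\<^sub>R U u \<le> 0" by (simp add: U_linear_simps \<open>U g = 0\<close>)
  moreover have "0 \<le> U u"
    using u by (intro U_nonneg[OF pos]) (simp add: quasi_interior_def less_imp_le)
  hence "0 \<le> c *\<^sub>R U u" using c by (simp add: scaleR_nonneg_nonneg)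
  ultimately have "c *\<^sub>R U u = 0" by (rule antisym)
  hence "U u = 0" using c by simp
  have "U f = 0" for f
    by (rule positive_operator_zero_at_quasi_interior[OF bounded_linear_U U_scaleC
        U_nonneg[OF pos] u \<open>U u = 0\<close>])
  thus False using U_nonzero by blast
qed

text \<open>For \<open>p \<ge> 2\<close> the operator \<open>U\<close> annihilates eigenvectors, in particular a vector \<open>U f > 0\<close>. But
  such a vector dominates \<open>u\<close>.\<close>

lemma strong_positivity_imp_simple_pole:
  assumes u: "quasi_interior u" and strong: "individually_strongly_positive l0 D A u"
  shows "p = 1"
proof (rule ccontr)
  assume "p \<noteq> 1"
  hence "p \<ge> 2" using p by linarith
  have pos: "individually_eventually_positive l0 D A"
    using strong u by (auto intro: strong_imp_eventual_positivity simp: quasi_interior_def)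
  obtain f where f: "0 \<le> f" "U f \<noteq> 0" using U_nonzero_at_positive by blast
  hence "0 < U f" using U_nonneg[OF pos f(1)] by (simp add: less_le)
  hence "U f \<succeq> u" by (rule eigenvector_dominates[OF strong _ U_in_eigenspace])
  moreover have "U (U f) = 0"
    using U_eigenvector[OF U_in_eigenspace, of f] \<open>p \<ge> 2\<close> by (simp add: power_0_left)
  ultimately show False using U_nonzero_at_dominating[OF u pos] by blast
qed

text \<open>If \<open>U f\<close> were zero then \<open>U\<close> would also vanish at \<open>(l - l0) R(l) f\<close>, as it commutes with the
  resolvent. But the latter vector dominates \<open>u\<close>.\<close>

lemma strong_positivity_imp_U_strictly_positive:
  assumes u: "quasi_interior u" and strong: "individually_strongly_positive l0 D A u"
    and f: "0 < f"
  shows "U f \<succeq> u"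
proof -
  have pos: "individually_eventually_positive l0 D A"
    using strong u by (auto intro: strong_imp_eventual_positivity simp: quasi_interior_def)
  have "\<forall>\<^sub>F l in at l0. (l - l0) *\<^sub>R R (complex_of_real l) f \<succeq> u"
    using strong f by (auto simp: individually_strongly_positive_def elim: eventually_mono)
  then obtain l where l: "complex_of_real l \<in> \<rho>" "(l - l0) *\<^sub>R R (complex_of_real l) f \<succeq> u"
    by (rule obtain_resolvent_point)
  have "U ((l - l0) *\<^sub>R R (complex_of_real l) f) = (l - l0) *\<^sub>R R (complex_of_real l) (U f)"
    by (simp add: U_linear_simps R_U_commute l)
  moreover have "U ((l - l0) *\<^sub>R R (complex_of_real l) f) \<noteq> 0"
    by (rule U_nonzero_at_dominating[OF u pos l(2)])
  ultimately have "U f \<noteq> 0"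
    using linear_simps(3)[OF bounded_linear_R[OF l(1)]] by auto
  hence "0 < U f" using U_nonneg[OF pos, of f] f by (simp add: less_le)
  thus ?thesis by (rule eigenvector_dominates[OF strong _ U_in_eigenspace])
qed

text \<open>For a positive eigenvector \<open>x\<close> let \<open>t\<close> be maximal with \<open>t v \<le> x\<close>; it exists because \<open>x\<close> lies
  in \<open>E\<^sub>u\<close> and the cone is closed. The positive eigenvector \<open>x - t v\<close> must vanish, as it would
  otherwise dominate \<open>u\<close> and hence \<open>v\<close>, so that \<open>t\<close> could be enlarged.\<close>

lemma positive_eigenvector_multiple:
  assumes u: "0 < u" and strong: "individually_strongly_positive l0 D A u"
    and D: "D \<subseteq> principal_ideal u"
    and v: "0 < v" "v \<in> eigenspace (complex_of_real l0) D A"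
    and x: "0 \<le> x" "x \<in> eigenspace (complex_of_real l0) D A"
  shows "x \<in> complexification.span {v}"
proof -
  have u0: "0 \<le> u" and v0: "0 \<le> v" using u v by (simp_all add: less_imp_le)
  have ideal: "x \<in> principal_ideal u" "v \<in> principal_ideal u"
    using D x v by (auto simp: eigenspace_def)
  have "v \<succeq> x"
    using eigenvector_dominates[OF strong v] by (rule dominates_trans_ideal[OF u0 _ x(1) ideal(1)])
  then obtain c where c: "c > 0" "c *\<^sub>R x \<le> v" by (auto simp: dominates_def)
  define T where "T = {t. t *\<^sub>R v \<le> x}"
  have bound: "t \<le> inverse c" if "t \<in> T" for t
  proof (rule ccontr)
    assume t: "\<not> ?thesis"
    have "c *\<^sub>R t *\<^sub>R v \<le> c *\<^sub>R x" using that c by (intro scaleR_left_mono) (auto simp: T_def)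
    also note c(2)
    finally have "(c * t - 1) *\<^sub>R v \<le> 0" by (simp add: scaleR_diff_left)
    moreover have "c * t - 1 > 0" using t c by (simp add: field_simps)
    moreover from this have "0 \<le> (c * t - 1) *\<^sub>R v" using v0 by (simp add: scaleR_nonneg_nonneg)
    ultimately have "(c * t - 1) *\<^sub>R v = 0" by (intro antisym)
    thus False using \<open>c * t - 1 > 0\<close> v(1) by simp
  qed
  have "T = (\<lambda>t. x - t *\<^sub>R v) -` {z. 0 \<le> z}" by (auto simp: T_def)
  hence "closed T"
    by (simp only:) (intro closed_vimage closed_nonneg_complexification continuous_intros)
  moreover have bdd: "bdd_above T" using bound by (rule bdd_aboveI)
  moreover have "0 \<in> T" using x by (simp add: T_def)
  ultimately have "Sup T \<in> T" by (intro closed_contains_Sup) auto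
  define y where "y = x - Sup T *\<^sub>R v"
  have y: "0 \<le> y" using \<open>Sup T \<in> T\<close> by (simp add: y_def T_def)
  have "y = 0"
  proof (rule ccontr)
    assume "y \<noteq> 0"
    hence "0 < y" using y by (simp add: less_le)
    moreover have "y \<in> eigenspace (complex_of_real l0) D A"
      unfolding y_def scaleC_of_real[symmetric]
      by (intro complexification.subspace_diff complexification.subspace_scale subspace_eigenspace
          v x)
    ultimately have "y \<succeq> u" by (rule eigenvector_dominates[OF strong])
    hence "y \<succeq> v" by (rule dominates_trans_ideal[OF u0 _ v0 ideal(2)])
    then obtain d where d: "d > 0" "d *\<^sub>R v \<le> y" by (auto simp: dominates_def)
    hence "Sup T + d \<in> T" by (simp add: T_def y_def scaleR_add_left algebra_simps)
    hence "Sup T + d \<le> Sup T" using bdd by (rule cSup_upper)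
    thus False using d by simp
  qed
  hence "x = complex_of_real (Sup T) *\<^sub>C v" by (simp add: y_def)
  thus ?thesis by (metis complexification.span_base complexification.span_scale singletonI)
qed

text \<open>The pole is simple, so \<open>U\<close> fixes the eigenvectors and the eigenspace is the range of \<open>U\<close>. All
  positive eigenvectors are multiples of \<open>v = U u\<close>, therefore \<open>U f = \<phi>(f) v\<close>. The functional \<open>\<phi>\<close> is
  a dual eigenvector because \<open>U\<close> commutes with the resolvent.\<close>

theorem strong_positivity_imp_spectral_assumption:
  assumes dense: "densely_defined D" and u: "quasi_interior u"
    and strong: "individually_strongly_positive l0 D A u" and D: "D \<subseteq> principal_ideal u"
  shows "spectral_assumption l0 D A u"
proof -
  let ?l0 = "complex_of_real l0"
  have u0: "0 < u" using u by (simp add: quasi_interior_def)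
  have pos: "individually_eventually_positive l0 D A"
    by (rule strong_imp_eventual_positivity[OF strong u0])
  have p1: "p = 1" by (rule strong_positivity_imp_simple_pole[OF u strong])
  have U_id: "U x = x" if "x \<in> eigenspace ?l0 D A" for x
    using U_eigenvector[OF that] p1 by simp
  define v where "v = U u"
  have v: "v \<succeq> u" "v \<in> eigenspace ?l0 D A"
    unfolding v_def
    by (rule strong_positivity_imp_U_strictly_positive[OF u strong u0], rule U_in_eigenspace)
  have v0: "0 < v" by (rule dominates_imp_pos[OF u0 v(1)])
  have U_span: "U f \<in> complexification.span {v}" for f
  proof -
    have "f \<in> {f. U f \<in> complexification.span {v}}"
    proof (rule complex_subspace_contains_all)
      show "complexification.subspace {f. U f \<in> complexification.span {v}}"
        by (auto intro!: complexification.subspaceI simp: U_linear_simps U_scaleC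
            complexification.span_zero complexification.span_add complexification.span_scale)
      show "f \<in> {f. U f \<in> complexification.span {v}}" if "0 \<le> f" for f
        using positive_eigenvector_multiple[OF u0 strong D v0 v(2) U_nonneg[OF pos that]
          U_in_eigenspace] by simp
    qed
    thus ?thesis by simp
  qed
  have eigenspace: "eigenspace ?l0 D A = complexification.span {v}"
  proof
    show "eigenspace ?l0 D A \<subseteq> complexification.span {v}" using U_span U_id by (metis subsetI)
    show "complexification.span {v} \<subseteq> eigenspace ?l0 D A"
      using v(2) by (intro complexification.span_minimal subspace_eigenspace) simp
  qed
  have "\<forall>f. \<exists>c. U f = c *\<^sub>C v" using U_span by (auto simp: complexification.span_singleton)
  then obtain \<phi> where \<phi>: "\<And>f. U f = \<phi> f *\<^sub>C v" by metis
  have \<phi>_eqI: "\<phi> f = c" if "U f = c *\<^sub>C v" for f c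
    using that \<phi>[of f] v0 complexification.scale_right_imp_eq[of v "\<phi> f" c] by auto
  have \<phi>_scale: "\<phi> (c *\<^sub>C f) = c * \<phi> f" for c f
    by (rule \<phi>_eqI, simp only: U_scaleC) (simp only: \<phi> complexification.scale_scale)
  have "bounded_linear \<phi>"
  proof (rule bounded_linear_intro)
    show "\<phi> (f + g) = \<phi> f + \<phi> g" for f g
      by (rule \<phi>_eqI, simp only: U_linear_simps) (simp only: \<phi> complexification.scale_left_distrib)
    show "\<phi> (r *\<^sub>R f) = r *\<^sub>R \<phi> f" for r f
      using \<phi>_scale[of "complex_of_real r" f] by (simp add: scaleR_conv_of_real)
    show "norm (\<phi> f) \<le> norm f * (onorm U / norm v)" for f
    proof -
      have "norm (\<phi> f) * norm v = norm (U f)" by (simp add: \<phi> norm_scaleC)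
      also have "\<dots> \<le> onorm U * norm f" by (rule onorm[OF bounded_linear_U])
      finally show ?thesis using v0 by (simp add: field_simps)
    qed
  qed
  hence dual: "\<phi> \<in> dual_space" using \<phi>_scale by (simp add: dual_space_def)
  have "0 < \<phi> f" if f: "0 < f" for f
  proof -
    have "0 < U f"
      by (rule dominates_imp_pos[OF u0 strong_positivity_imp_U_strictly_positive[OF u strong f]])
    hence pv: "0 < \<phi> f *\<^sub>C v" by (simp add: \<phi>)
    have v': "im v = 0" "0 < re v" using v0 by (auto simp: less_complexification_def)
    have im0: "Im (\<phi> f) = 0" using pv v' by (auto simp: less_complexification_def)
    have "0 < Re (\<phi> f) *\<^sub>R re v" using pv v' by (simp add: less_complexification_def)
    hence "0 < Re (\<phi> f)"
      using v' scaleR_nonpos_nonneg[of "Re (\<phi> f)" "re v"] by (meson less_imp_le not_less order.asym leD)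
    thus ?thesis using im0 by (simp add: less_complex_def)
  qed
  hence strict: "strictly_positive \<phi>" using dual by (simp add: strictly_positive_def)
  have "\<phi> (A x) = ?l0 * \<phi> x" if x: "x \<in> D" for x
  proof (rule \<phi>_eqI)
    obtain m where m: "complex_of_real m \<in> \<rho>" using obtain_resolvent_point[of "\<lambda>_. True"] by auto
    let ?m = "complex_of_real m"
    define y where "y = ?m *\<^sub>C x - A x"
    have "R ?m y = x" by (rule R_eqI[OF m x]) (simp add: y_def)
    hence "(?m - ?l0) *\<^sub>C U x = U y"
      using R_eigenvector[OF m U_in_eigenspace, of y] R_U_commute[OF m, of y] by simp
    moreover have "U (A x) = ?m *\<^sub>C U x - U y"
      by (simp add: y_def U_linear_simps U_scaleC flip: scaleC_of_real)
    ultimately have "U (A x) = ?m *\<^sub>C U x - (?m - ?l0) *\<^sub>C U x" by simp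
    also have "\<dots> = ?l0 *\<^sub>C U x" unfolding complexification.scale_left_diff_distrib by simp
    also have "\<dots> = (?l0 * \<phi> x) *\<^sub>C v" by (simp only: \<phi> complexification.scale_scale)
    finally show "U (A x) = (?l0 * \<phi> x) *\<^sub>C v" .
  qed
  hence "\<phi> \<in> dual_eigenspace ?l0 D A" using dual by (simp add: mem_dual_eigenspace_iff[OF dense])
  moreover have "complexification.dim (eigenspace ?l0 D A) = 1"
  proof -
    have "complexification.independent {v}"
      using v0 by (simp add: complexification.independent_insert)
    from complexification.dim_span_eq_card_independent[OF this] show ?thesis
      unfolding eigenspace by simp
  qed
  ultimately show ?thesis
    unfolding spectral_assumption_def using eigenspace v(1) strict by blast
qed

section \<open>The spectral assumption implies strong positivity\<close>

text \<open>The vector \<open>U f\<close> is a multiple \<open>c v\<close> of the eigenvector \<open>v\<close>, so it is determined by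
  \<open>\<phi> (U f) = c \<phi>(v)\<close>, where \<open>\<phi>(v) > 0\<close>. As \<open>\<phi> ((l - l0) R(l) f) = \<phi>(f)\<close>, this number is \<open>\<phi>(f)\<close> for a
  simple pole and \<open>0\<close> for a pole of higher order; in the latter case \<open>U\<close> would be zero.\<close>

lemma spectral_assumption_imp_simple_pole_and_positive_residue:
  assumes dense: "densely_defined D" and u: "0 < u" and spec: "spectral_assumption l0 D A u"
  shows "p = 1" "\<And>f. 0 < f \<Longrightarrow> U f \<succeq> u"
proof -
  let ?l0 = "complex_of_real l0"
  from spec obtain v \<phi> where v: "eigenspace ?l0 D A = complexification.span {v}" "v \<succeq> u"
    and \<phi>: "\<phi> \<in> dual_eigenspace ?l0 D A" "strictly_positive \<phi>"
    unfolding spectral_assumption_def by blast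
  have v0: "0 < v" by (rule dominates_imp_pos[OF u v(2)])
  have \<phi>v: "0 < \<phi> v" using \<phi>(2) v0 by (simp add: strictly_positive_def)
  have dual: "bounded_linear \<phi>" "\<And>c x. \<phi> (c *\<^sub>C x) = c * \<phi> x"
    and \<phi>A: "\<And>x. x \<in> D \<Longrightarrow> \<phi> (A x) = ?l0 * \<phi> x"
    using \<phi>(1) by (auto simp: mem_dual_eigenspace_iff[OF dense] dual_space_def)
  interpret \<phi>: bounded_linear \<phi> by (rule dual(1))
  have \<phi>R: "(l - l0) *\<^sub>R \<phi> (R (complex_of_real l) f) = \<phi> f" if l: "complex_of_real l \<in> \<rho>" for l f
  proof -
    have "?l0 * \<phi> (R (complex_of_real l) f) = \<phi> (complex_of_real l *\<^sub>C R (complex_of_real l) f - f)"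
      using \<phi>A[OF R_mem_D[OF l], of f] unfolding A_R[OF l] by simp
    also have "\<dots> = complex_of_real l * \<phi> (R (complex_of_real l) f) - \<phi> f"
      by (simp only: \<phi>.diff dual(2))
    finally show ?thesis by (simp add: scaleR_conv_of_real algebra_simps)
  qed
  have \<phi>U: "\<phi> (U f) = 0 ^ (p - 1) *\<^sub>R \<phi> f" for f
  proof -
    have "((\<lambda>l. \<phi> ((l - l0) ^ p *\<^sub>R R (complex_of_real l) f)) \<longlongrightarrow> \<phi> (U f)) (at l0)"
      by (intro \<phi>.tendsto tendsto_U)
    moreover have "\<forall>\<^sub>F l in at l0. \<phi> ((l - l0) ^ p *\<^sub>R R (complex_of_real l) f)
        = (l - l0) ^ (p - 1) *\<^sub>R \<phi> f"
      using eventually_resolvent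
    proof eventually_elim
      case (elim l)
      have "(l - l0) ^ p = (l - l0) ^ (p - 1) * (l - l0)" using p by (simp flip: power_Suc2)
      thus ?case using \<phi>R[OF elim, of f] by (simp only: \<phi>.scaleR flip: scaleR_scaleR)
    qed
    ultimately have "((\<lambda>l. (l - l0) ^ (p - 1) *\<^sub>R \<phi> f) \<longlongrightarrow> \<phi> (U f)) (at l0)"
      by (rule Lim_transform_eventually)
    moreover have "((\<lambda>l. (l - l0) ^ (p - 1) *\<^sub>R \<phi> f) \<longlongrightarrow> (l0 - l0) ^ (p - 1) *\<^sub>R \<phi> f) (at l0)"
      by (intro tendsto_intros)
    ultimately have "\<phi> (U f) = (l0 - l0) ^ (p - 1) *\<^sub>R \<phi> f" by (rule tendsto_unique[OF at_neq_bot])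
    thus ?thesis by simp
  qed
  have U_v: "\<exists>c. U f = c *\<^sub>C v \<and> c * \<phi> v = \<phi> (U f)" for f
  proof -
    obtain c where "U f = c *\<^sub>C v"
      using U_in_eigenspace[of f] unfolding v(1) complexification.span_singleton by blast
    thus ?thesis using dual(2) by auto
  qed
  show p1: "p = 1"
  proof (rule ccontr)
    assume "p \<noteq> 1"
    hence "\<phi> (U f) = 0" for f using \<phi>U[of f] p by (simp add: power_0_left)
    hence "U f = 0" for f using U_v[of f] \<phi>v by auto
    thus False using U_nonzero by blast
  qed
  show "U f \<succeq> u" if f: "0 < f" for f
  proof -
    have \<phi>f: "0 < \<phi> f" using \<phi>(2) f by (simp add: strictly_positive_def)
    obtain c where c: "U f = c *\<^sub>C v" "c * \<phi> v = \<phi> f" using U_v[of f] \<phi>U[of f] p1 by auto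
    have *: "Im (\<phi> v) = 0" "0 < Re (\<phi> v)" "Im (\<phi> f) = 0" "0 < Re (\<phi> f)"
      using \<phi>v \<phi>f by (auto simp: less_complex_def)
    have "Im c * Re (\<phi> v) = 0" "Re c * Re (\<phi> v) = Re (\<phi> f)"
      using arg_cong[OF c(2), of Im] arg_cong[OF c(2), of Re] * by simp_all
    hence "Im c = 0" "0 < Re c" using * by (auto simp: zero_less_mult_iff dest: sym[of _ "Re (\<phi> f)"])
    hence "U f = Re c *\<^sub>R v" "0 < Re c"
      using c(1) scaleC_of_real[of "Re c" v] by (simp_all add: complex_is_Real_iff of_real_Re)
    thus ?thesis using v(2) by (simp add: dominates_scaleR_pos)
  qed
qed

text \<open>If \<open>dom A\<close> is contained in \<open>E\<^sub>u\<close>, then \<open>(l - l0) R(l) f\<close> converges to the residue \<open>U f\<close> not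
  only in norm but even relative to \<open>u\<close>, because the difference is \<open>R(a)\<close> applied to a null
  function. A lower bound \<open>c u\<close> for \<open>U f\<close> therefore survives near \<open>l0\<close>.\<close>

theorem spectral_assumption_imp_strong_positivity:
  assumes dense: "densely_defined D" and real: "real_operator D A" and u: "0 < u"
    and spec: "spectral_assumption l0 D A u" and D: "D \<subseteq> principal_ideal u"
  shows "individually_strongly_positive l0 D A u"
  unfolding individually_strongly_positive_def
proof (intro allI impI)
  fix f :: "'a complexification" assume f: "0 < f"
  note simple = spectral_assumption_imp_simple_pole_and_positive_residue[OF dense u spec]
  have u0: "0 \<le> u" "im u = 0" "0 \<le> re u"
    using u by (auto simp: less_complexification_def less_eq_complexification_def)
  obtain a where a: "complex_of_real a \<in> \<rho>" using obtain_resolvent_point[of "\<lambda>_. True"] by auto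
  let ?Ra = "R (complex_of_real a)" and ?T = "\<lambda>l. (l - l0) *\<^sub>R R (complex_of_real l) f"
  interpret Ra: bounded_linear ?Ra by (rule bounded_linear_R[OF a])
  have "?Ra g \<in> principal_ideal u" for g using R_mem_D[OF a] D by blast
  then obtain C where C: "C > 0" "\<And>g. modulus (?Ra g) \<le> (C * norm g) *\<^sub>R re u"
    using bounded_operator_into_principal_ideal[OF bounded_linear_R[OF a] u0(1)] by blast
  obtain c where c: "c > 0" "c *\<^sub>R u \<le> U f"
    using simple(2)[OF f] by (auto simp: dominates_def)
  \<comment> \<open>By the resolvent identity, \<open>R(a) (h l)\<close> is the difference of \<open>(l - l0) R(l) f\<close> and its limit
    \<open>U f\<close>.\<close>
  define h where "h l = (l - l0) *\<^sub>R f + (a - l) *\<^sub>R ?T l - (a - l0) *\<^sub>R U f" for l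
  have "(?T \<longlongrightarrow> U f) (at l0)" using tendsto_U[of f] simple(1) by simp
  hence "(h \<longlongrightarrow> (l0 - l0) *\<^sub>R f + (a - l0) *\<^sub>R U f - (a - l0) *\<^sub>R U f) (at l0)"
    unfolding h_def by (intro tendsto_intros)
  hence "((\<lambda>l. C * norm (h l)) \<longlongrightarrow> 0) (at l0)"
    by (simp add: tendsto_mult_right_zero tendsto_norm_zero)
  hence "\<forall>\<^sub>F l in at l0. C * norm (h l) < c / 2" using c by (intro order_tendstoD(2)) auto
  with eventually_resolvent
  show "\<forall>\<^sub>F l in at l0. complex_of_real l \<in> \<rho> \<and> ?T l \<succeq> u"
  proof eventually_elim
    case (elim l)
    have "?T l = (l - l0) *\<^sub>R (?Ra f + (a - l) *\<^sub>R ?Ra (R (complex_of_real l) f))"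
      using resolvent_identity_real[OF elim(1) a, of f] resolvent_commute[OF elim(1) a, of f] by simp
    also have "\<dots> = (l - l0) *\<^sub>R ?Ra f + (a - l) *\<^sub>R ?Ra (?T l)"
      by (simp only: Ra.scaleR scaleR_add_right scaleR_left_commute)
    finally have T: "?T l = (l - l0) *\<^sub>R ?Ra f + (a - l) *\<^sub>R ?Ra (?T l)" .
    have Uf: "U f = (a - l0) *\<^sub>R ?Ra (U f)"
      using T_eigenvector[OF a U_in_eigenspace] by simp
    have "?Ra (h l) = (l - l0) *\<^sub>R ?Ra f + (a - l) *\<^sub>R ?Ra (?T l) - (a - l0) *\<^sub>R ?Ra (U f)"
      by (simp only: h_def Ra.add Ra.diff Ra.scaleR)
    hence diff: "?T l - U f = ?Ra (h l)" using arg_cong2[OF T Uf, of "(-)"] by metis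
    have "- re (?Ra (h l)) \<le> modulus (?Ra (h l))"
      using abs_ge_minus_self abs_re_le_modulus by (rule order_trans)
    also have "\<dots> \<le> (C * norm (h l)) *\<^sub>R re u" by (rule C)
    also have "\<dots> \<le> (c / 2) *\<^sub>R re u" using elim(2) u0 by (intro scaleR_right_mono) auto
    finally have "- ((c / 2) *\<^sub>R re u) \<le> re (?T l - U f)" unfolding diff by (simp add: minus_le_iff)
    moreover have "c *\<^sub>R re u \<le> re (U f)" using c by (simp add: less_eq_complexification_def)
    ultimately have "- ((c / 2) *\<^sub>R re u) + c *\<^sub>R re u \<le> re (?T l - U f) + re (U f)" by (rule add_mono)
    hence "(- (c / 2) + c) *\<^sub>R re u \<le> re (?T l)" by (simp only: scaleR_add_left) simp
    hence "(c / 2) *\<^sub>R re u \<le> re (?T l)" by simp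
    moreover have "im (?T l) = 0"
      using R_real[OF real elim(1), of f] f by (simp add: less_complexification_def)
    ultimately have "(c / 2) *\<^sub>R u \<le> ?T l" using u0 by (simp add: less_eq_complexification_def)
    thus ?case using elim(1) c(1) unfolding dominates_def by (meson half_gt_zero)
  qed
qed

end

section \<open>The characterization\<close>

theorem theorem1p2:
  fixes D :: "'a :: banach_lattice complexification set"
    and A :: "'a complexification \<Rightarrow> 'a complexification"
    and l0 :: real
    and u :: "'a complexification"
  assumes "linear_operator D A"
    and "closed_operator D A"
    and "densely_defined D"
    and "real_operator D A"
    and "complex_of_real l0 isolated_in op_spectrum D A"
    and "pole_of_resolvent (complex_of_real l0) D A"
    and "quasi_interior u"
    and "\<exists>n. dom_power D A n \<subseteq> principal_ideal u"
  shows
    "((\<forall>f > 0.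
        (\<exists>\<epsilon>>0. \<forall>\<mu>\<in>{l0 - \<epsilon><..<l0}.
          complex_of_real \<mu> \<in> resolvent_set D A \<and> resolvent (complex_of_real \<mu>) D A f \<preceq> - u) \<and>
        (\<exists>\<epsilon>>0. \<forall>l\<in>{l0<..<l0 + \<epsilon>}.
          complex_of_real l \<in> resolvent_set D A \<and> resolvent (complex_of_real l) D A f \<succeq> u))
      \<longleftrightarrow> (spectral_assumption l0 D A u \<and> D \<subseteq> principal_ideal u))
    \<and> ((spectral_assumption l0 D A u \<and>
        (\<forall>f \<ge> 0.
          (\<exists>\<epsilon>>0. \<forall>\<mu>\<in>{l0 - \<epsilon><..<l0}.
            complex_of_real \<mu> \<in> resolvent_set D A \<and> resolvent (complex_of_real \<mu>) D A f \<le> 0) \<and>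
          (\<exists>\<epsilon>>0. \<forall>l\<in>{l0<..<l0 + \<epsilon>}.
            complex_of_real l \<in> resolvent_set D A \<and> 0 \<le> resolvent (complex_of_real l) D A f)))
      \<longleftrightarrow> (spectral_assumption l0 D A u \<and> D \<subseteq> principal_ideal u))"
proof -
  interpret complex_linear_operator D A using assms(1) by unfold_locales
  obtain p U where "resolvent_pole D A l0 p U"
    using assms(6) by (rule pole_of_resolvent_imp_resolvent_pole)
  then interpret resolvent_pole D A l0 p U .
  obtain n where n: "dom_power D A n \<subseteq> principal_ideal u" using assms(8) by blast
  have u: "0 < u" "0 \<le> u" using assms(7) by (simp_all add: quasi_interior_def less_imp_le)
  note domain = eventual_positivity_imp_domain_subset[OF _ u(2) n]
  have i_iii: "individually_strongly_positive l0 D A u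
      \<longleftrightarrow> spectral_assumption l0 D A u \<and> D \<subseteq> principal_ideal u"
    using strong_positivity_imp_spectral_assumption[OF assms(3,7)] domain
      strong_imp_eventual_positivity[OF _ u(1)]
      spectral_assumption_imp_strong_positivity[OF assms(3,4) u(1)]
    by blast
  have ii_iii: "spectral_assumption l0 D A u \<and> individually_eventually_positive l0 D A
      \<longleftrightarrow> spectral_assumption l0 D A u \<and> D \<subseteq> principal_ideal u"
    using i_iii domain strong_imp_eventual_positivity[OF _ u(1)] by blast
  show ?thesis
    unfolding strong_positivity_iff eventual_positivity_iff using i_iii ii_iii by (rule conjI)
qed

end
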